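(* Let $k$ and $p$ be positive integers such that $$k > \sqrt{\frac{p^2(p^2-1)}{6}\cdot\left\lfloor\frac{p+2}{2}\right\rfloor}.$$ Then $\mathcal{C}_{\mathrm{exp}}(k,p) > 0$, that is, there exists an explicit linear multistep method with $k$ steps, order of accuracy $p$ and SSP coefficient $\mathcal{C} > 0$.
   Context: A linear multistep method (LM method) with $k$ steps computes $u_n = \sum_{j=1}^{k} \alpha_j u_{n-j} + h \sum_{j=0}^k \beta_j f(u_{n-j})$ and is identified with its real coefficients $(\alpha_j)_{j=1}^k$, $(\beta_j)_{j=0}^k$ (no requirement that $\alpha_k$ or $\beta_k$ be non-zero). It is explicit if $\beta_0=0$. With the convention $0^0=1$, it has order (of accuracy, of consistency) $p$ if $\sum_{j=1}^{k}\alpha_j=1$ and $\sum_{j=1}^{k}(j^m\alpha_j - m j^{m-1}\beta_j) - m\,0^{m-1}\beta_0=0$ for all $1\le m\le p$. The SSP coefficient of a method is $\mathcal{C}=\min\{\alpha_j/\beta_j : 1\le j\le k,\ \beta_j\ne 0\}$ (with $\min\emptyset=+\infty$) if $\alpha_j\ge 0$ for $1\le j\le k$ and $\beta_j\ge 0$ for $0\le j\le k$, and $\mathcal{C}=0$ otherwise. $\mathcal{C}_{\mathrm{exp}}(k,p)$ is the supremum of $\mathcal{C}$ over all explicit $k$-step LM methods of order $p$, taken to be $0$ if there are no such methods. *)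

theory Defs
  imports "HOL-Analysis.Analysis"
begin

text \<open>
  A linear multistep method with \<open>k\<close> steps,
  \<open>u n = (\<Sum>j=1..k. \<alpha> j * u (n - j)) + h * (\<Sum>j=0..k. \<beta> j * f (u (n - j)))\<close>,
  is identified with its coefficients. They are given by functions
  \<open>\<alpha> \<beta> :: nat \<Rightarrow> real\<close>, of which only the values \<open>\<alpha> j\<close> for \<open>1 \<le> j \<le> k\<close> and
  \<open>\<beta> j\<close> for \<open>0 \<le> j \<le> k\<close> are ever used.
\<close>

definition lm_explicit :: "(nat \<Rightarrow> real) \<Rightarrow> bool" where
  "lm_explicit \<beta> \<longleftrightarrow> \<beta> 0 = 0"

text \<open>Order \<open>p\<close> means order at least \<open>p\<close>. The term for \<open>\<beta> 0\<close> contributes only when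
  \<open>m = 1\<close>, because \<open>0 ^ 0 = 1\<close>.\<close>

definition lm_order :: "nat \<Rightarrow> (nat \<Rightarrow> real) \<Rightarrow> (nat \<Rightarrow> real) \<Rightarrow> nat \<Rightarrow> bool" where
  "lm_order k \<alpha> \<beta> p \<longleftrightarrow>
     (\<Sum>j=1..k. \<alpha> j) = 1 \<and>
     (\<forall>m\<in>{1..p}.
        (\<Sum>j=1..k. real j ^ m * \<alpha> j - real m * real j ^ (m - 1) * \<beta> j)
          - real m * 0 ^ (m - 1) * \<beta> 0 = 0)"

definition ssp_coeff :: "nat \<Rightarrow> (nat \<Rightarrow> real) \<Rightarrow> (nat \<Rightarrow> real) \<Rightarrow> ereal" where
  "ssp_coeff k \<alpha> \<beta> =
     (if (\<forall>j\<in>{1..k}. \<alpha> j \<ge> 0) \<and> (\<forall>j\<in>{0..k}. \<beta> j \<ge> 0)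
      then (let R = {\<alpha> j / \<beta> j | j. j \<in> {1..k} \<and> \<beta> j \<noteq> 0}
            in if R = {} then \<infinity> else ereal (Min R))
      else 0)"

text \<open>The case distinction is needed because \<open>Sup {} = -\<infinity>\<close> in \<^typ>\<open>ereal\<close>.\<close>

definition C_exp :: "nat \<Rightarrow> nat \<Rightarrow> ereal" where
  "C_exp k p =
     (let S = {ssp_coeff k \<alpha> \<beta> | \<alpha> \<beta>. lm_explicit \<beta> \<and> lm_order k \<alpha> \<beta> p}
      in if S = {} then 0 else Sup S)"

end

theory Submission
  imports Defs
begin

text \<open>
  By Stiemke's lemma there is an explicit method with all \<open>\<alpha> j\<close> and \<open>\<beta> j\<close>, \<open>1 \<le> j \<le> k\<close>, positive, provided
  that \<open>0\<close> is the only polynomial \<open>q\<close> of degree at most \<open>p\<close> with \<open>q 0 \<le> 0\<close>, \<open>q j \<ge> 0\<close> and \<open>q' j \<le> 0\<close> for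
  \<open>1 \<le> j \<le> k\<close>. For such a \<open>q\<close> let \<open>M\<close> be its oscillation on \<open>[0, k]\<close>. As \<open>q 0 \<le> q k\<close>, \<open>M\<close> is at most the
  total rise of \<open>q\<close>, the integral of the positive part of \<open>q'\<close>. If \<open>L\<close> bounds \<open>\<bar>q''\<bar>\<close> on \<open>[0, k]\<close>, then \<open>q\<close> rises by at
  most \<open>L / 2\<close> on \<open>[0, 1]\<close> and by at most \<open>L / 4\<close> on every later unit interval. Only \<open>N\<close> of the latter contain
  a rise, where \<open>2 N + 1 \<le> p - 1\<close> by counting roots of \<open>q'\<close>, so \<open>M \<le> (\<lfloor>p / 2\<rfloor> + 1) L / 4\<close>. V. A. Markov's
  inequality for the second derivative allows \<open>L = 2 p\<^sup>2 (p\<^sup>2 - 1) M / (3 k\<^sup>2)\<close>, and the hypothesis on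
  \<open>k\<close> forces \<open>M = 0\<close>.

  For Markov's inequality, at an interior maximum of \<open>\<bar>q''\<bar>\<close> one has \<open>3 x q'' = D\<close> with
  \<open>D = 3 x q'' - (1 - x\<^sup>2) q'''\<close>, and \<open>D\<close> is bounded sharply, in two rounds, by Lagrange interpolation at the zeros of
  the Chebyshev polynomial \<open>T n\<close>. Near \<open>x = 0\<close>, where dividing by \<open>x\<close> is too costly, integrating the bound on \<open>D\<close>
  suffices.
\<close>

subsection \<open>Theorems of the alternative\<close>

text \<open>Induction on the rows. If the implication fails without row \<open>h\<close>, any
  counterexample violates row \<open>h\<close>; projecting along it onto the kernel of row
  \<open>h\<close> removes that row from the system.\<close>

lemma farkas:
  fixes A :: "'i \<Rightarrow> 'j \<Rightarrow> real" and b :: "'j \<Rightarrow> real"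
  assumes "finite I" and J: "finite J"
    and "\<And>x. (\<And>i. i \<in> I \<Longrightarrow> 0 \<le> (\<Sum>j\<in>J. A i j * x j)) \<Longrightarrow> 0 \<le> (\<Sum>j\<in>J. b j * x j)"
  shows "\<exists>y. (\<forall>i\<in>I. 0 \<le> y i) \<and> (\<forall>j\<in>J. b j = (\<Sum>i\<in>I. y i * A i j))"
  using assms(1,3)
proof (induction I arbitrary: A b rule: finite_induct)
  case empty
  have "0 \<le> (\<Sum>j\<in>J. b j * (- b j))"
    by (rule empty) auto
  hence "(\<Sum>j\<in>J. b j * b j) \<le> 0"
    by (simp add: sum_negf)
  hence "(\<Sum>j\<in>J. b j * b j) = 0"
    by (meson antisym sum_nonneg zero_le_square)
  hence "\<forall>j\<in>J. b j = 0"
    using J by (subst (asm) sum_nonneg_eq_0_iff) auto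
  thus ?case by simp
next
  case (insert h I)
  show ?case
  proof (cases "\<forall>x. (\<forall>i\<in>I. 0 \<le> (\<Sum>j\<in>J. A i j * x j)) \<longrightarrow> 0 \<le> (\<Sum>j\<in>J. b j * x j)")
    case True
    then obtain y where y: "\<forall>i\<in>I. 0 \<le> y i" "\<forall>j\<in>J. b j = (\<Sum>i\<in>I. y i * A i j)"
      using insert.IH[of A b] by blast
    have "(\<Sum>i\<in>insert h I. (y(h := 0)) i * A i j) = (\<Sum>i\<in>I. y i * A i j)" for j
      using insert.hyps by (auto intro!: sum.cong)
    thus ?thesis using y by (intro exI[of _ "y(h := 0)"]) auto
  next
    case False
    then obtain v where v: "\<And>i. i \<in> I \<Longrightarrow> 0 \<le> (\<Sum>j\<in>J. A i j * v j)" "(\<Sum>j\<in>J. b j * v j) < 0"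
      by (auto simp: not_le)
    have hv: "(\<Sum>j\<in>J. A h j * v j) < 0"
      using insert.prems[of v] v by force
    define u where "u j = v j / (- (\<Sum>j\<in>J. A h j * v j))" for j
    have in_u: "(\<Sum>j\<in>J. a j * u j) = (\<Sum>j\<in>J. a j * v j) / (- (\<Sum>j\<in>J. A h j * v j))" for a
      unfolding u_def by (simp add: sum_divide_distrib sum_negf)
    have hu: "(\<Sum>j\<in>J. A h j * u j) = -1"
      using hv by (subst in_u) (simp add: field_simps)
    have Iu: "0 \<le> (\<Sum>j\<in>J. A i j * u j)" if "i \<in> I" for i
      using hv v(1)[OF that] by (subst in_u) (intro divide_nonneg_nonneg; linarith)
    have bu: "(\<Sum>j\<in>J. b j * u j) \<le> 0"
      using hv v(2) by (subst in_u) (intro divide_nonpos_nonneg; linarith)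
    \<comment> \<open>\<open>sh\<close> is the projection along \<open>u\<close> onto the kernel of
      row \<open>h\<close>; \<open>pr\<close> is its transpose, acting on rows. It annihilates
      \<open>A h\<close>, so the induction hypothesis needs only the projected rows of
      \<open>I\<close>.\<close>
    define pr where "pr a j = a j + (\<Sum>j\<in>J. a j * u j) * A h j" for a :: "'j \<Rightarrow> real" and j
    define sh where "sh x j = x j + (\<Sum>j\<in>J. A h j * x j) * u j" for x :: "'j \<Rightarrow> real" and j
    have adj: "(\<Sum>j\<in>J. pr a j * x j) = (\<Sum>j\<in>J. a j * sh x j)" for a x
    proof -
      have "(\<Sum>j\<in>J. pr a j * x j) = (\<Sum>j\<in>J. a j * x j) + (\<Sum>j\<in>J. a j * u j) * (\<Sum>j\<in>J. A h j * x j)"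
        unfolding pr_def by (simp add: algebra_simps sum.distrib sum_distrib_left)
      moreover have "(\<Sum>j\<in>J. a j * sh x j) = (\<Sum>j\<in>J. a j * x j) + (\<Sum>j\<in>J. A h j * x j) * (\<Sum>j\<in>J. a j * u j)"
        unfolding sh_def distrib_left sum.distrib by (simp add: sum_distrib_left mult.left_commute)
      ultimately show ?thesis by simp
    qed
    have hsh: "(\<Sum>j\<in>J. A h j * sh x j) = 0" for x
    proof -
      have "pr (A h) = (\<lambda>j. 0)" unfolding pr_def hu by auto
      thus ?thesis unfolding adj[symmetric] by simp
    qed
    have "\<exists>y. (\<forall>i\<in>I. 0 \<le> y i) \<and> (\<forall>j\<in>J. pr b j = (\<Sum>i\<in>I. y i * pr (A i) j))"
    proof (rule insert.IH)
      fix x assume "\<And>i. i \<in> I \<Longrightarrow> 0 \<le> (\<Sum>j\<in>J. pr (A i) j * x j)"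
      thus "0 \<le> (\<Sum>j\<in>J. pr b j * x j)"
        unfolding adj using hsh by (intro insert.prems) auto
    qed
    then obtain y where y: "\<And>i. i \<in> I \<Longrightarrow> 0 \<le> y i"
        "\<And>j. j \<in> J \<Longrightarrow> pr b j = (\<Sum>i\<in>I. y i * pr (A i) j)"
      by blast
    \<comment> \<open>The multiplier of row \<open>h\<close> collects what \<open>pr\<close> added
      to \<open>b\<close> and to the other rows; the signs in \<open>Iu\<close> and
      \<open>bu\<close> make it nonnegative.\<close>
    define c where "c = (\<Sum>i\<in>I. y i * (\<Sum>j\<in>J. A i j * u j)) - (\<Sum>j\<in>J. b j * u j)"
    have "c \<ge> 0"
      unfolding c_def using bu sum_nonneg[of I "\<lambda>i. y i * (\<Sum>j\<in>J. A i j * u j)"] y(1) Iu by fastforce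
    have "b j = (\<Sum>i\<in>insert h I. (y(h := c)) i * A i j)" if "j \<in> J" for j
    proof -
      have "b j = (\<Sum>i\<in>I. y i * A i j) + c * A h j"
        using y(2)[OF that] unfolding pr_def c_def
        by (simp add: algebra_simps sum.distrib sum_distrib_left)
      also have "(\<Sum>i\<in>I. y i * A i j) = (\<Sum>i\<in>I. (y(h := c)) i * A i j)"
        using insert.hyps by (intro sum.cong) auto
      finally show ?thesis using insert.hyps by simp
    qed
    thus ?thesis using y(1) \<open>c \<ge> 0\<close> by (intro exI[of _ "y(h := c)"]) auto
  qed
qed

text \<open>Row \<open>l\<close> vanishes on every solution, so Farkas' lemma writes its negative as
  a nonnegative combination of the rows. Adding row \<open>l\<close> itself and summing over all
  \<open>l\<close> makes every weight at least \<open>1\<close>.\<close>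

lemma stiemke:
  fixes A :: "'i \<Rightarrow> 'j \<Rightarrow> real"
  assumes I: "finite I" and J: "finite J"
    and triv: "\<And>x i. (\<And>i. i \<in> I \<Longrightarrow> 0 \<le> (\<Sum>j\<in>J. A i j * x j)) \<Longrightarrow> i \<in> I \<Longrightarrow> (\<Sum>j\<in>J. A i j * x j) = 0"
  shows "\<exists>y. (\<forall>i\<in>I. 0 < y i) \<and> (\<forall>j\<in>J. (\<Sum>i\<in>I. y i * A i j) = 0)"
proof -
  have "\<exists>y. (\<forall>i\<in>I. 0 \<le> y i) \<and> (\<forall>j\<in>J. - A l j = (\<Sum>i\<in>I. y i * A i j))" if "l \<in> I" for l
  proof (rule farkas[OF I J])
    fix x assume "\<And>i. i \<in> I \<Longrightarrow> 0 \<le> (\<Sum>j\<in>J. A i j * x j)"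
    from triv[OF this that] show "0 \<le> (\<Sum>j\<in>J. - A l j * x j)" by (simp add: sum_negf)
  qed
  then obtain y where y: "\<And>l i. l \<in> I \<Longrightarrow> i \<in> I \<Longrightarrow> 0 \<le> y l i"
      "\<And>l j. l \<in> I \<Longrightarrow> j \<in> J \<Longrightarrow> - A l j = (\<Sum>i\<in>I. y l i * A i j)"
    by metis
  have "(\<Sum>i\<in>I. (1 + (\<Sum>l\<in>I. y l i)) * A i j) = 0" if "j \<in> J" for j
  proof -
    have "(\<Sum>i\<in>I. (\<Sum>l\<in>I. y l i) * A i j) = (\<Sum>l\<in>I. \<Sum>i\<in>I. y l i * A i j)"
      unfolding sum_distrib_right by (rule sum.swap)
    also have "\<dots> = (\<Sum>l\<in>I. - A l j)"
      using y(2) that by (intro sum.cong) auto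
    finally show ?thesis by (simp add: distrib_right sum.distrib sum_negf)
  qed
  moreover have "0 < 1 + (\<Sum>l\<in>I. y l i)" if "i \<in> I" for i
    using sum_nonneg[of I "\<lambda>l. y l i"] y(1) that by fastforce
  ultimately show ?thesis by (intro exI[of _ "\<lambda>i. 1 + (\<Sum>l\<in>I. y l i)"]) auto
qed

subsection \<open>Interpolation at Chebyshev nodes\<close>

lemmas pderiv_sum = higher_pderiv_sum[where n = 1, simplified]

lemma prod_linear_factors_nonneg:
  fixes x :: "'a \<Rightarrow> real"
  assumes "finite S" and "\<And>j. j \<in> S \<Longrightarrow> x j \<le> y"
  shows "poly (\<Prod>j\<in>S. [:- x j, 1:]) y \<ge> 0 \<and> poly (pderiv (\<Prod>j\<in>S. [:- x j, 1:])) y \<ge> 0"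
  using assms
proof (induction S rule: finite_induct)
  case (insert s S)
  have "poly (\<Prod>j\<in>S. [:- x j, 1:]) y \<ge> 0" "poly (pderiv (\<Prod>j\<in>S. [:- x j, 1:])) y \<ge> 0" "x s \<le> y"
    using insert by auto
  thus ?case
    unfolding prod.insert[OF insert.hyps] pderiv_mult
    using mult_nonneg_nonneg[of "y - x s" "poly (\<Prod>j\<in>S. [:- x j, 1:]) y"]
      mult_nonneg_nonneg[of "y - x s" "poly (pderiv (\<Prod>j\<in>S. [:- x j, 1:])) y"]
    by (simp add: pderiv_pCons algebra_simps)
qed simp

lemma lagrange_interpolation:
  fixes x :: "nat \<Rightarrow> real"
  assumes inj: "inj_on x {..<n}" and deg: "degree P < n"
  shows "P = (\<Sum>i<n. smult (poly P (x i) / (\<Prod>j\<in>{..<n}-{i}. x i - x j)) (\<Prod>j\<in>{..<n}-{i}. [:- x j, 1:]))"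
    (is "P = ?Q")
proof (rule poly_eqI_degree[where A = "x ` {..<n}"])
  have "poly (\<Prod>j\<in>{..<n}-{i}. [:- x j, 1:]) (x l) = (if l = i then (\<Prod>j\<in>{..<n}-{i}. x i - x j) else 0)"
    if "i < n" "l < n" for i l
    using that by (auto simp: poly_prod intro!: prod_zero)
  moreover have "(\<Prod>j\<in>{..<n}-{i}. x i - x j) \<noteq> 0" if "i < n" for i
    using inj that by (auto simp: inj_on_def)
  ultimately have "poly ?Q (x l) = (\<Sum>i<n. if l = i then poly P (x i) else 0)" if "l < n" for l
    unfolding poly_sum poly_smult using that by (intro sum.cong) auto
  thus "poly P z = poly ?Q z" if "z \<in> x ` {..<n}" for z
    using that by auto
  have card: "card (x ` {..<n}) = n"
    using inj by (simp add: card_image)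
  show "degree P < card (x ` {..<n})" using deg card by simp
  have "degree ?Q \<le> n - 1"
  proof (rule degree_sum_le)
    fix i assume "i \<in> {..<n}"
    have "degree (\<Prod>j\<in>{..<n}-{i}. [:- x j, 1:]) \<le> (\<Sum>j\<in>{..<n}-{i}. 1)"
      by (rule order.trans[OF degree_prod_sum_le]) auto
    also have "\<dots> = n - 1" using \<open>i \<in> {..<n}\<close> by simp
    finally show "degree (smult (poly P (x i) / (\<Prod>j\<in>{..<n}-{i}. x i - x j)) (\<Prod>j\<in>{..<n}-{i}. [:- x j, 1:])) \<le> n - 1"
      by (meson degree_smult_le order.trans)
  qed simp
  thus "degree ?Q < card (x ` {..<n})" using deg card by simp
qed

text \<open>At a point right of all nodes, the numerators of the Lagrange basis and their
  derivatives are nonnegative, and the denominators \<open>w i\<close> have sign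
  \<open>(-1) ^ i\<close>. So all terms of the interpolation sum of \<open>Q\<close> are
  nonnegative, and each dominates that of \<open>P\<close>.\<close>

lemma alternating_dominance:
  fixes P Q :: "real poly" and x :: "nat \<Rightarrow> real"
  assumes deg: "degree P < n" "degree Q < n"
    and dec: "\<And>i j. i < j \<Longrightarrow> j < n \<Longrightarrow> x j < x i"
    and dom: "\<And>i. i < n \<Longrightarrow> \<bar>poly P (x i)\<bar> \<le> (-1) ^ i * poly Q (x i)"
    and y: "\<And>i. i < n \<Longrightarrow> x i \<le> y"
  shows "\<bar>poly P y\<bar> \<le> poly Q y" "\<bar>poly (pderiv P) y\<bar> \<le> poly (pderiv Q) y"
proof -
  define w where "w i = (\<Prod>j\<in>{..<n}-{i}. x i - x j)" for i
  define g where "g i = (\<Prod>j\<in>{..<n}-{i}. [:- x j, 1:])" for i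
  have inj: "inj_on x {..<n}"
    by (rule inj_onI) (metis dec lessThan_iff less_irrefl linorder_neqE_nat)
  have w_sgn: "(-1) ^ i * w i > 0" if "i < n" for i
  proof -
    have *: "{..<n} - {i} = {..<i} \<union> {i<..<n}" using that by auto
    have "w i = (\<Prod>j<i. x i - x j) * (\<Prod>j\<in>{i<..<n}. x i - x j)"
      unfolding w_def * by (rule prod.union_disjoint) auto
    moreover have "(-1) ^ i * (\<Prod>j<i. x i - x j) = (\<Prod>j<i. x j - x i)"
      using prod_uminus[of "\<lambda>j. x i - x j" "{..<i}"] by simp
    moreover have "(\<Prod>j<i. x j - x i) > 0" "(\<Prod>j\<in>{i<..<n}. x i - x j) > 0"
      using dec that by (auto intro!: prod_pos)
    ultimately show ?thesis
      by (metis mult.assoc mult_pos_pos)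
  qed
  have main: "\<bar>\<Sum>i<n. poly P (x i) / w i * c i\<bar> \<le> (\<Sum>i<n. poly Q (x i) / w i * c i)"
    if c: "\<And>i. i < n \<Longrightarrow> c i \<ge> 0" for c
  proof (rule order.trans[OF sum_abs], rule sum_mono)
    fix i assume "i \<in> {..<n}"
    hence i: "i < n" by simp
    have "\<bar>w i\<bar> = \<bar>(-1) ^ i * w i\<bar>" by (simp add: abs_mult)
    hence "\<bar>w i\<bar> = (-1) ^ i * w i" using w_sgn[OF i] by linarith
    hence "\<bar>poly P (x i) / w i * c i\<bar> = \<bar>poly P (x i)\<bar> / ((-1) ^ i * w i) * c i"
      unfolding abs_mult abs_divide using c[OF i] by (simp only: abs_of_nonneg)
    also have "\<dots> \<le> ((-1) ^ i * poly Q (x i)) / ((-1) ^ i * w i) * c i"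
      using w_sgn[OF i] c[OF i] dom[OF i] by (intro mult_right_mono divide_right_mono) auto
    also have "\<dots> = poly Q (x i) / w i * c i" by simp
    finally show "\<bar>poly P (x i) / w i * c i\<bar> \<le> poly Q (x i) / w i * c i" .
  qed
  have g: "poly (g i) y \<ge> 0" "poly (pderiv (g i)) y \<ge> 0" if "i < n" for i
    using prod_linear_factors_nonneg[of "{..<n}-{i}" x y] y unfolding g_def by auto
  have ev: "poly R y = (\<Sum>i<n. poly R (x i) / w i * poly (g i) y)" 
     "poly (pderiv R) y = (\<Sum>i<n. poly R (x i) / w i * poly (pderiv (g i)) y)"
    if "degree R < n" for R
  proof -
    have R: "R = (\<Sum>i<n. smult (poly R (x i) / w i) (g i))"
      using lagrange_interpolation[OF inj that] unfolding w_def g_def .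
    show "poly R y = (\<Sum>i<n. poly R (x i) / w i * poly (g i) y)"
      by (subst R) (simp add: poly_sum)
    show "poly (pderiv R) y = (\<Sum>i<n. poly R (x i) / w i * poly (pderiv (g i)) y)"
      by (subst R) (simp add: poly_sum pderiv_sum pderiv_smult)
  qed
  show "\<bar>poly P y\<bar> \<le> poly Q y" "\<bar>poly (pderiv P) y\<bar> \<le> poly (pderiv Q) y"
    using main g ev deg by auto
qed

text \<open>The Chebyshev polynomials of the second kind; \<open>sin_cheb_U\<close> is their
  trigonometric characterisation.\<close>

fun cheb_U :: "nat \<Rightarrow> real poly" where
  "cheb_U 0 = 1"
| "cheb_U (Suc 0) = [:0, 2:]"
| "cheb_U (Suc (Suc n)) = [:0, 2:] * cheb_U (Suc n) - cheb_U n"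

lemma sin_cheb_U: "sin t * poly (cheb_U n) (cos t) = sin (real (Suc n) * t)"
proof (induction n rule: cheb_U.induct)
  case 2
  show ?case using sin_double[of t] by simp
next
  case (3 n)
  have "sin t * poly (cheb_U (Suc (Suc n))) (cos t)
      = 2 * cos t * sin (real (Suc (Suc n)) * t) - sin (real (Suc n) * t)"
    unfolding 3[symmetric] by (simp add: algebra_simps)
  also have "\<dots> = sin (real (Suc (Suc (Suc n))) * t)"
    using sin_add[of "real (Suc (Suc n)) * t" t] sin_diff[of "real (Suc (Suc n)) * t" t]
    by (simp add: algebra_simps)
  finally show ?case .
qed simp

lemma degree_cheb_U: "degree (cheb_U n) \<le> n"
proof (induction n rule: cheb_U.induct)
  case (3 n)
  have "degree ([:0, 2:] * cheb_U (Suc n)) \<le> Suc (Suc n)"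
    using degree_mult_le[of "[:0, 2::real:]" "cheb_U (Suc n)"] 3 by simp
  thus ?case using 3 by (auto intro!: degree_diff_le)
qed auto

lemma poly_cheb_U_1: "poly (cheb_U n) 1 = real n + 1"
  by (induction n rule: cheb_U.induct) auto

lemma poly_pderiv_cheb_U_1: "poly (pderiv (cheb_U n)) 1 = real n * (real n + 1) * (real n + 2) / 3"
  by (induction n rule: cheb_U.induct)
     (auto simp: pderiv_mult pderiv_diff pderiv_smult pderiv_pCons poly_cheb_U_1 field_simps)

text \<open>The nodes \<open>cos (t i)\<close> are the zeros of the Chebyshev polynomial
  \<open>T (n + 1)\<close>. There \<open>C * cheb_U n\<close> touches the envelope
  \<open>C / sin t\<close> with alternating signs, while \<open>R\<close> stays within it. The
  largest node is \<open>cos (t 0)\<close>, the bound on \<open>y\<close>.\<close>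

lemma weighted_dominance:
  fixes R :: "real poly"
  assumes deg: "degree R \<le> n"
    and bd: "\<And>t. \<bar>sin t * poly R (cos t)\<bar> \<le> C"
    and y: "y \<ge> cos (pi / (2 * (real n + 1)))"
  shows "\<bar>poly R y\<bar> \<le> C * poly (cheb_U n) y" "\<bar>poly (pderiv R) y\<bar> \<le> C * poly (pderiv (cheb_U n)) y"
proof -
  define t where "t i = (2 * real i + 1) * pi / (2 * (real n + 1))" for i
  have t0: "0 < t i" for i unfolding t_def by (intro divide_pos_pos mult_pos_pos) auto
  have tpi: "t i < pi" if "i < Suc n" for i
  proof -
    have "(2 * real i + 1) * pi < (2 * (real n + 1)) * pi"
      using that by (intro mult_strict_right_mono) auto
    thus ?thesis unfolding t_def by (simp add: field_simps)
  qed
  have tmono: "t i < t j" if "i < j" for i j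
    using that unfolding t_def by (intro divide_strict_right_mono mult_strict_right_mono) auto
  have dec: "cos (t j) < cos (t i)" if "i < j" "j < Suc n" for i j
    using tmono[OF that(1)] t0[of i] tpi[OF that(2)] by (intro cos_monotone_0_pi) auto
  have U: "sin (t i) * poly (cheb_U n) (cos (t i)) = (-1) ^ i" for i
  proof -
    have "real (Suc n) * t i = real i * pi + pi / 2"
      unfolding t_def by (simp add: field_simps)
    thus ?thesis unfolding sin_cheb_U by (simp add: sin_add cos_npi)
  qed
  have dom: "\<bar>poly R (cos (t i))\<bar> \<le> (-1) ^ i * poly (smult C (cheb_U n)) (cos (t i))" if "i < Suc n" for i
  proof -
    have s: "sin (t i) > 0" using t0 tpi[OF that] by (intro sin_gt_zero) auto
    have "sin (t i) * ((-1) ^ i * poly (cheb_U n) (cos (t i))) = (-1) ^ i * (-1) ^ i"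
      by (subst mult.left_commute) (simp only: U)
    hence "C = sin (t i) * ((-1) ^ i * poly (smult C (cheb_U n)) (cos (t i)))"
      by (simp add: power_mult_distrib[symmetric] algebra_simps)
    moreover have "sin (t i) * \<bar>poly R (cos (t i))\<bar> \<le> C"
      using bd[of "t i"] s by (simp add: abs_mult)
    ultimately show ?thesis using s by (metis mult_le_cancel_left_pos)
  qed
  have y': "cos (t i) \<le> y" if "i < Suc n" for i
  proof -
    have "t 0 \<le> t i" using tmono[of 0 i] by (cases "i = 0") auto
    hence "cos (t i) \<le> cos (t 0)" using t0[of 0] tpi[OF that] by (intro cos_monotone_0_pi_le) auto
    thus ?thesis using y by (simp add: t_def)
  qed
  have deg': "degree R < Suc n" "degree (smult C (cheb_U n)) < Suc n"
    using deg degree_cheb_U[of n] degree_smult_le[of C "cheb_U n"] by auto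
  from alternating_dominance[OF deg' dec dom y']
  show "\<bar>poly R y\<bar> \<le> C * poly (cheb_U n) y" "\<bar>poly (pderiv R) y\<bar> \<le> C * poly (pderiv (cheb_U n)) y"
    by (simp_all add: pderiv_smult)
qed

subsection \<open>Markov's inequality for the second derivative\<close>

text \<open>Horner's rule reduces the claim to multiplication by \<open>cos t\<close>, and the
  product formula for \<open>cos t * cos (m t)\<close> raises the frequency by at most one.\<close>

lemma poly_cos_expansion:
  fixes q :: "real poly"
  assumes "degree q \<le> n"
  shows "\<exists>a. \<forall>t. poly q (cos t) = (\<Sum>m\<le>n. a m * cos (real m * t))"
  using assms
proof (induction n arbitrary: q)
  case 0
  then obtain c where "q = [:c:]" by (auto elim: degree_eq_zeroE)
  thus ?case by (intro exI[of _ "\<lambda>_. c"]) simp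
next
  case (Suc n)
  define E where "E f \<longleftrightarrow> (\<exists>a. \<forall>t. f t = (\<Sum>m\<le>Suc n. a m * cos (real m * t)))" for f :: "real \<Rightarrow> real"
  have E_add: "E (\<lambda>t. f t + g t)" if "E f" "E g" for f g
  proof -
    from that obtain a b where "\<And>t. f t = (\<Sum>m\<le>Suc n. a m * cos (real m * t))"
        "\<And>t. g t = (\<Sum>m\<le>Suc n. b m * cos (real m * t))"
      unfolding E_def by auto
    thus ?thesis unfolding E_def
      by (intro exI[of _ "\<lambda>m. a m + b m"]) (simp add: sum.distrib[symmetric] distrib_right del: sum.atMost_Suc)
  qed
  have E_scale: "E (\<lambda>t. c * f t)" if "E f" for c f
  proof -
    from that obtain a where "\<And>t. f t = (\<Sum>m\<le>Suc n. a m * cos (real m * t))"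
      unfolding E_def by auto
    thus ?thesis unfolding E_def
      by (intro exI[of _ "\<lambda>m. c * a m"]) (simp add: sum_distrib_left mult.assoc del: sum.atMost_Suc)
  qed
  have E_cos: "E (\<lambda>t. cos (real l * t))" if "l \<le> Suc n" for l
    unfolding E_def
  proof (intro exI[of _ "\<lambda>m. if m = l then 1 else 0"] allI)
    fix t
    have "(\<Sum>m\<le>Suc n. (if m = l then 1 else 0) * cos (real m * t))
        = (\<Sum>m\<le>Suc n. if m = l then cos (real m * t) else 0)"
      by (intro sum.cong) auto
    thus "cos (real l * t) = (\<Sum>m\<le>Suc n. (if m = l then 1 else 0) * cos (real m * t))"
      using that by simp
  qed
  have E_sum: "E (\<lambda>t. \<Sum>m\<in>S. f m t)" if "finite S" "\<And>m. m \<in> S \<Longrightarrow> E (f m)" for S :: "nat set" and f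
    using that
  proof (induction S rule: finite_induct)
    case empty
    show ?case using E_scale[OF E_cos[of 0], of 0] by simp
  qed (simp add: E_add)
  have E_cos_mult: "E (\<lambda>t. cos t * cos (real m * t))" if "m \<le> n" for m
  proof (cases m)
    case 0
    thus ?thesis using E_cos[of 1] by simp
  next
    case (Suc l)
    have "E (\<lambda>t. (1/2) * (cos (real (Suc m) * t) + cos (real l * t)))"
      using that Suc by (intro E_scale E_add E_cos) auto
    moreover have "(1/2) * (cos (real (Suc m) * t) + cos (real l * t)) = cos t * cos (real m * t)" for t
      using cos_add[of "real m * t" t] cos_diff[of "real m * t" t] Suc by (simp add: algebra_simps)
    ultimately show ?thesis by simp
  qed
  obtain c r where q: "q = pCons c r" by (cases q)
  hence "degree r \<le> n" using Suc.prems by (auto split: if_splits)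
  then obtain a where a: "\<And>t. poly r (cos t) = (\<Sum>m\<le>n. a m * cos (real m * t))"
    using Suc.IH by metis
  have "E (\<lambda>t. c * cos (real 0 * t) + (\<Sum>m\<in>{..n}. a m * (cos t * cos (real m * t))))"
    by (intro E_add E_sum E_scale E_cos_mult E_cos) auto
  moreover have "poly q (cos t) = c * cos (real 0 * t) + (\<Sum>m\<in>{..n}. a m * (cos t * cos (real m * t)))" for t
    unfolding q poly_pCons a by (simp add: sum_distrib_left algebra_simps)
  ultimately show ?case unfolding E_def by simp
qed

text \<open>If \<open>f t = poly q (cos t)\<close>, then \<open>sin t * poly (osc q) (cos t) = f''' t + f' t\<close>. At a critical point \<open>x\<close> of
  \<open>q''\<close> the value of \<open>osc q\<close> is \<open>3 x q'' x\<close>.\<close>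

definition osc :: "real poly \<Rightarrow> real poly" where
  "osc q = [:0, 3:] * pderiv (pderiv q) - [:1, 0, -1:] * pderiv (pderiv (pderiv q))"

lemma degree_osc:
  assumes "degree q \<le> Suc n"
  shows "degree (osc q) \<le> n"
proof -
  have d: "degree (pderiv (pderiv q)) \<le> n - 1" "degree (pderiv (pderiv (pderiv q))) \<le> n - 2"
    using assms by (auto simp: degree_pderiv)
  have "degree ([:0, 3:] * pderiv (pderiv q)) \<le> n"
  \<comment> \<open>For small \<open>n\<close> the truncated subtractions in \<open>d\<close> give
    too weak a bound; the derivative involved is then zero.\<close>
  proof (cases "n = 0")
    case True
    hence "degree (pderiv q) = 0" using assms by (simp add: degree_pderiv)
    hence "pderiv (pderiv q) = 0" by (simp add: pderiv_eq_0_iff)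
    thus ?thesis by simp
  qed (use d(1) degree_mult_le[of "[:0, 3::real:]" "pderiv (pderiv q)"] in simp)
  moreover have "degree ([:1, 0, -1:] * pderiv (pderiv (pderiv q))) \<le> n"
  proof (cases "n \<le> 1")
    case True
    hence "degree (pderiv (pderiv q)) = 0" using assms by (simp add: degree_pderiv)
    hence "pderiv (pderiv (pderiv q)) = 0" by (simp add: pderiv_eq_0_iff)
    thus ?thesis by simp
  qed (use d(2) degree_mult_le[of "[:1, 0, -1::real:]" "pderiv (pderiv (pderiv q))"] in simp)
  ultimately show ?thesis unfolding osc_def by (rule degree_diff_le)
qed

text \<open>Differentiating both expressions for \<open>f t = poly q (cos t)\<close> three times
  gives the facts \<open>1\<close>, \<open>2\<close> and \<open>3\<close> about \<open>- f'\<close>,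
  \<open>- f''\<close> and \<open>- f'''\<close>. In \<open>f''' + f'\<close> the terms in
  \<open>q'\<close> cancel, which leaves the left-hand side.\<close>

lemma sin_osc:
  assumes q: "\<And>t. poly q (cos t) = (\<Sum>m\<le>n. a m * cos (real m * t))"
  shows "sin t * poly (osc q) (cos t) = (\<Sum>m\<le>n. a m * (real m ^ 3 - real m) * sin (real m * t))"
proof -
  note [derivative_intros] = DERIV_chain2[OF poly_DERIV]
  have 1: "sin t * poly (pderiv q) (cos t) = (\<Sum>m\<le>n. a m * real m * sin (real m * t))" for t
  proof -
    have "((\<lambda>t. poly q (cos t)) has_real_derivative (- (sin t * poly (pderiv q) (cos t)))) (at t)"
      by (auto intro!: derivative_eq_intros)
    moreover have "((\<lambda>t. poly q (cos t)) has_real_derivative (- (\<Sum>m\<le>n. a m * real m * sin (real m * t)))) (at t)"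
      unfolding q by (auto intro!: derivative_eq_intros sum.cong simp: sum_negf[symmetric])
    ultimately show ?thesis using DERIV_unique by fastforce
  qed
  have 2: "cos t * poly (pderiv q) (cos t) - (sin t)\<^sup>2 * poly (pderiv (pderiv q)) (cos t)
      = (\<Sum>m\<le>n. a m * real m ^ 2 * cos (real m * t))" for t
  proof -
    have "((\<lambda>t. sin t * poly (pderiv q) (cos t)) has_real_derivative
        (cos t * poly (pderiv q) (cos t) - (sin t)\<^sup>2 * poly (pderiv (pderiv q)) (cos t))) (at t)"
      by (auto intro!: derivative_eq_intros simp: power2_eq_square)
    moreover have "((\<lambda>t. sin t * poly (pderiv q) (cos t)) has_real_derivative
        (\<Sum>m\<le>n. a m * real m ^ 2 * cos (real m * t))) (at t)"
      unfolding 1 by (auto intro!: derivative_eq_intros sum.cong simp: power2_eq_square)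
    ultimately show ?thesis by (rule DERIV_unique)
  qed
  have 3: "- sin t * poly (pderiv q) (cos t) - 3 * sin t * cos t * poly (pderiv (pderiv q)) (cos t)
       + (sin t)^3 * poly (pderiv (pderiv (pderiv q))) (cos t)
      = - (\<Sum>m\<le>n. a m * real m ^ 3 * sin (real m * t))"
  proof -
    have "((\<lambda>t. cos t * poly (pderiv q) (cos t) - (sin t)\<^sup>2 * poly (pderiv (pderiv q)) (cos t)) has_real_derivative
        (- sin t * poly (pderiv q) (cos t) - 3 * sin t * cos t * poly (pderiv (pderiv q)) (cos t)
       + (sin t)^3 * poly (pderiv (pderiv (pderiv q))) (cos t))) (at t)"
      by (auto intro!: derivative_eq_intros simp: power2_eq_square power3_eq_cube algebra_simps)
    moreover have "((\<lambda>t. cos t * poly (pderiv q) (cos t) - (sin t)\<^sup>2 * poly (pderiv (pderiv q)) (cos t)) has_real_derivative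
        - (\<Sum>m\<le>n. a m * real m ^ 3 * sin (real m * t))) (at t)"
      unfolding 2 by (auto intro!: derivative_eq_intros sum.cong simp: power2_eq_square power3_eq_cube sum_negf[symmetric])
    ultimately show ?thesis by (rule DERIV_unique)
  qed
  have s: "(sin t)^3 = sin t * (1 - (cos t)\<^sup>2)"
    by (simp add: power3_eq_cube power2_eq_square[symmetric] sin_squared_eq[symmetric])
  have "sin t * poly (osc q) (cos t)
     = 3 * sin t * cos t * poly (pderiv (pderiv q)) (cos t) - (sin t)^3 * poly (pderiv (pderiv (pderiv q))) (cos t)"
    unfolding s osc_def by (simp add: algebra_simps power2_eq_square)
  also have "\<dots> = (\<Sum>m\<le>n. a m * real m ^ 3 * sin (real m * t)) - (\<Sum>m\<le>n. a m * real m * sin (real m * t))"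
    using 3 1[of t] by (simp add: algebra_simps)
  also have "\<dots> = (\<Sum>m\<le>n. a m * (real m ^ 3 - real m) * sin (real m * t))"
    by (simp add: sum_subtractf[symmetric] algebra_simps)
  finally show ?thesis .
qed

text \<open>First round of interpolation: \<open>weighted_dominance\<close> bounds the derivative of
  an auxiliary polynomial at \<open>1\<close> by \<open>B\<close> times that of
  \<open>cheb_U n\<close>. The constant is sharp: with \<open>B = 1\<close> it is attained for the
  Chebyshev polynomial \<open>T (n + 1)\<close>.\<close>

lemma osc_bound:
  assumes deg: "degree q \<le> Suc n"
    and bd: "\<And>x. -1 \<le> x \<Longrightarrow> x \<le> 1 \<Longrightarrow> \<bar>poly q x\<bar> \<le> B"
  shows "\<bar>sin t * poly (osc q) (cos t)\<bar> \<le> B * (real n * (real n + 1) * (real n + 2))"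
proof -
  obtain a where a: "\<And>t. poly q (cos t) = (\<Sum>m\<le>Suc n. a m * cos (real m * t))"
    using poly_cos_expansion[OF deg] by blast
  \<comment> \<open>The odd part of \<open>u \<mapsto> poly q (cos (t - u))\<close> is \<open>sin u * poly R (cos u)\<close>; the third order Taylor
    coefficients at \<open>u = 0\<close> give \<open>f''' t + f' t = 3 R' 1\<close> for \<open>f u = poly q (cos u)\<close>.\<close>
  define R where "R = (\<Sum>m\<le>n. smult (a (Suc m) * sin (real (Suc m) * t)) (cheb_U m))"
  have degR: "degree R \<le> n" unfolding R_def
    by (rule degree_sum_le) (auto intro: order.trans[OF degree_smult_le] order.trans[OF degree_cheb_U])
  have "\<bar>sin u * poly R (cos u)\<bar> \<le> B" for u
  proof -
    have "sin u * poly R (cos u) = (\<Sum>m\<le>n. a (Suc m) * sin (real (Suc m) * t) * sin (real (Suc m) * u))"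
      unfolding R_def poly_sum poly_smult sum_distrib_left
      by (intro sum.cong refl) (subst sin_cheb_U[symmetric], simp)
    also have "\<dots> = (\<Sum>m\<le>Suc n. a m * sin (real m * t) * sin (real m * u))"
      by (subst sum.atMost_Suc_shift) simp
    also have "\<dots> = (\<Sum>m\<le>Suc n. a m * cos (real m * (t - u)) - a m * cos (real m * (t + u))) / 2"
      unfolding sum_divide_distrib
      by (intro sum.cong refl) (simp add: ring_distribs cos_add cos_diff)
    also have "\<dots> = (poly q (cos (t - u)) - poly q (cos (t + u))) / 2"
      unfolding a by (simp only: sum_subtractf)
    finally show ?thesis using bd[of "cos (t - u)"] bd[of "cos (t + u)"] by simp
  qed
  from weighted_dominance(2)[OF degR this, of 1]
  have "\<bar>poly (pderiv R) 1\<bar> \<le> B * (real n * (real n + 1) * (real n + 2) / 3)"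
    by (simp add: poly_pderiv_cheb_U_1)
  moreover have "3 * poly (pderiv R) 1 = sin t * poly (osc q) (cos t)"
  proof -
    have "3 * poly (pderiv R) 1 = (\<Sum>m\<le>n. a (Suc m) * (real (Suc m) ^ 3 - real (Suc m)) * sin (real (Suc m) * t))"
      unfolding R_def pderiv_sum pderiv_smult poly_sum poly_smult poly_pderiv_cheb_U_1 sum_distrib_left
      by (intro sum.cong refl) (simp add: field_simps power3_eq_cube)
    also have "\<dots> = (\<Sum>m\<le>Suc n. a m * (real m ^ 3 - real m) * sin (real m * t))"
      by (subst sum.atMost_Suc_shift) simp
    also have "\<dots> = sin t * poly (osc q) (cos t)"
      using sin_osc[OF a] by simp
    finally show ?thesis .
  qed
  ultimately show ?thesis by (simp add: field_simps)
qed

text \<open>The difference of the two sides vanishes at \<open>0\<close> and has derivative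
  \<open>n (cos (2 u) - cos (n u))\<close>, which is nonnegative because
  \<open>2 u \<le> n u \<le> pi\<close>.\<close>

lemma sin_mult_le:
  assumes "n \<ge> 2" "0 \<le> t" "real n * t \<le> pi / 2"
  shows "sin (real n * t) \<le> real n * (sin t * cos t)"
proof -
  define g where "g u = real n * (sin u * cos u) - sin (real n * u)" for u
  have "g 0 \<le> g t"
  proof (rule DERIV_nonneg_imp_nondecreasing[OF assms(2)])
    fix u assume u: "0 \<le> u" "u \<le> t"
    have "(g has_real_derivative real n * (cos u * cos u - sin u * sin u) - real n * cos (real n * u)) (at u)"
      unfolding g_def by (auto intro!: derivative_eq_intros simp: algebra_simps)
    moreover have "cos (real n * u) \<le> cos (2 * u)"
    proof (rule cos_monotone_0_pi_le)
      show "2 * u \<le> real n * u" using assms(1) u by (intro mult_right_mono) auto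
      have "real n * u \<le> real n * t" using u by (intro mult_left_mono) auto
      thus "real n * u \<le> pi" using assms(3) pi_gt_zero by linarith
    qed (use u in auto)
    ultimately show "\<exists>y. (g has_real_derivative y) (at u) \<and> 0 \<le> y"
      by (intro exI[of _ "real n * (cos u * cos u - sin u * sin u) - real n * cos (real n * u)"])
         (auto simp: cos_double power2_eq_square intro: mult_left_mono)
  qed
  thus ?thesis by (simp add: g_def)
qed

text \<open>With \<open>y = cos t\<close> this is \<open>sin_mult_le\<close> for
  \<open>n + 1\<close>, divided by \<open>sin t\<close>. The factor \<open>y\<close> on the right
  will cancel against the one in \<open>3 y q'' y\<close>.\<close>

lemma poly_cheb_U_le:
  assumes "n \<ge> 1" "cos (pi / (2 * (real n + 1))) \<le> y" "y \<le> 1"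
  shows "poly (cheb_U n) y \<le> (real n + 1) * y"
proof (cases "y = 1")
  case True
  thus ?thesis by (simp add: poly_cheb_U_1)
next
  case False
  have "pi / (2 * (real n + 1)) \<le> pi / 2"
    by (intro divide_left_mono) auto
  hence "0 \<le> cos (pi / (2 * (real n + 1)))" by (intro cos_ge_zero) (auto intro: order.trans[of _ 0])
  hence y: "0 \<le> y" "y < 1" using assms False by auto
  define t where "t = arccos y"
  have t: "cos t = y" "0 < t" "t < pi" using y False by (auto simp: t_def arccos_lt_bounded)
  have "t \<le> arccos (cos (pi / (2 * (real n + 1))))"
    unfolding t_def using assms y by (intro arccos_le_arccos) auto
  also have "\<dots> = pi / (2 * (real n + 1))"
    using \<open>pi / (2 * (real n + 1)) \<le> pi / 2\<close> pi_gt_zero by (intro arccos_cos) (simp, linarith)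
  finally have "real (Suc n) * t \<le> pi / 2" by (simp add: field_simps)
  from sin_mult_le[OF _ _ this] assms(1) t
  have "sin t * poly (cheb_U n) y \<le> sin t * ((real n + 1) * y)"
    using sin_cheb_U[of t n] by (simp add: algebra_simps)
  thus ?thesis using t sin_gt_zero[of t] by simp
qed

text \<open>Let \<open>y = cos t\<close>. Right of the largest node, a second round of interpolation
  bounds \<open>osc q\<close> by a multiple of \<open>y\<close>. From there to
  \<open>t = pi / 4\<close>, the bound of \<open>osc_bound\<close> is divided by
  \<open>sin t * cos t\<close>. Beyond, it is integrated.\<close>

lemma markov_second_critical:
  assumes deg: "degree q \<le> Suc n" and n: "n \<ge> 1"
    and bd: "\<And>x. -1 \<le> x \<Longrightarrow> x \<le> 1 \<Longrightarrow> \<bar>poly q x\<bar> \<le> B"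
    and y: "0 \<le> y" "y \<le> 1" and crit: "y = 1 \<or> poly (pderiv (pderiv (pderiv q))) y = 0"
  shows "\<bar>poly (pderiv (pderiv q)) y\<bar> \<le> B * (real n * (real n + 1) * (real n + 2)) * (real n + 1) / 3"
proof -
  define K where "K = B * (real n * (real n + 1) * (real n + 2))"
  have "B \<ge> 0" using bd[of 0] by simp
  hence K: "K \<ge> 0" unfolding K_def by simp
  have ob: "\<bar>sin t * poly (osc q) (cos t)\<bar> \<le> K" for t
    using osc_bound[OF deg bd] unfolding K_def by blast
  \<comment> \<open>At \<open>z = 1\<close> the factor \<open>1 - z ^ 2\<close> kills the third
    derivative; elsewhere criticality does.\<close>
  have D_crit: "3 * (z * poly (pderiv (pderiv q)) z) = poly (osc q) z"
    if "z = 1 \<or> poly (pderiv (pderiv (pderiv q))) z = 0" for z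
    using that unfolding osc_def by auto
  have edge: "\<bar>poly (pderiv (pderiv q)) z\<bar> \<le> K * (real n + 1) / 3"
    if z: "cos (pi / (2 * (real n + 1))) \<le> z" "0 < z" "z \<le> 1"
      and crit: "z = 1 \<or> poly (pderiv (pderiv (pderiv q))) z = 0" for z
  proof -
    have "\<bar>3 * (z * poly (pderiv (pderiv q)) z)\<bar> \<le> K * poly (cheb_U n) z"
      unfolding D_crit[OF crit] by (rule weighted_dominance(1)[OF degree_osc[OF deg] ob z(1)])
    also have "\<dots> \<le> K * ((real n + 1) * z)"
      using K poly_cheb_U_le[OF n z(1,3)] by (rule mult_left_mono[rotated])
    finally have "z * (3 * \<bar>poly (pderiv (pderiv q)) z\<bar>) \<le> z * (K * (real n + 1))"
      using z by (simp add: abs_mult algebra_simps)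
    thus ?thesis using z by simp
  qed
  define t where "t = arccos y"
  have t: "cos t = y" "0 \<le> t" "t \<le> pi / 2" 
    using y arccos_lbound[of y] arccos_le_pi2[of y] by (auto simp: t_def simp del: arccos_le_pi2)
  consider "cos (pi / (2 * (real n + 1))) \<le> y" "y > 0"
    | "n = 1"
    | "n \<ge> 2" "y < cos (pi / (2 * (real n + 1)))" "t \<le> pi / 4"
    | "n \<ge> 2" "y < cos (pi / (2 * (real n + 1)))" "t > pi / 4"
  proof -
    have "cos (pi / (2 * (real n + 1))) > 0"
    proof (rule cos_gt_zero_pi)
      have "pi / (2 * (real n + 1)) > 0" by simp
      thus "- (pi / 2) < pi / (2 * (real n + 1))" using pi_gt_zero by linarith
      show "pi / (2 * (real n + 1)) < pi / 2" using n by (intro divide_strict_left_mono) auto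
    qed
    thus ?thesis using that n by (metis Suc_1 Suc_leI le_neq_implies_less less_le_trans not_le)
  qed
  thus ?thesis
  proof cases
    case 1
    show ?thesis using edge[OF 1 y(2) crit] unfolding K_def .
  next
    case 2
    \<comment> \<open>Here \<open>q''\<close> is constant, so its value at \<open>y\<close> equals
      that at \<open>1\<close>, where \<open>edge\<close> applies.\<close>
    have "degree (pderiv (pderiv q)) = 0" using deg 2 by (simp add: degree_pderiv)
    then obtain c where "pderiv (pderiv q) = [:c:]" by (auto elim: degree_eq_zeroE)
    thus ?thesis using edge[of 1] unfolding K_def by simp
  next
    case 3
    define t0 where "t0 = pi / (2 * (real n + 1))"
    have t0: "0 < t0" "t0 \<le> pi" "real (Suc n) * t0 = pi / 2"
      using pi_gt_zero unfolding t0_def by (auto simp: field_simps intro: order.trans[of _ pi])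
    have "t0 < t"
    proof (rule ccontr)
      assume "\<not> t0 < t"
      hence "cos t0 \<le> cos t" using t t0 by (intro cos_monotone_0_pi_le) auto
      thus False using 3(2) t by (simp add: t0_def)
    qed
    have s: "sin t > 0" using t \<open>t0 < t\<close> t0 pi_gt_zero by (intro sin_gt_zero) auto
    have c: "cos t > 0" using 3(3) t pi_gt_zero by (intro cos_gt_zero_pi) linarith+
    \<comment> \<open>At \<open>t0\<close> the left side of \<open>sin_mult_le\<close> is
      \<open>sin (pi / 2) = 1\<close>, and \<open>sin t * cos t = sin (2 t) / 2\<close> increases up
      to \<open>t = pi / 4\<close>. So dividing by it costs at most the factor
      \<open>n + 1\<close>.\<close>
    have "1 \<le> (real n + 1) * (sin t0 * cos t0)"
      using sin_mult_le[of "Suc n" t0, unfolded t0(3)] n t0(1) by (simp add: add.commute)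
    also have "\<dots> = (real n + 1) * (sin (2 * t0) / 2)" by (simp add: sin_double)
    also have "\<dots> \<le> (real n + 1) * (sin (2 * t) / 2)"
      using \<open>t0 < t\<close> t0 3(3) by (intro mult_left_mono divide_right_mono sin_monotone_2pi_le) auto
    also have "\<dots> = (real n + 1) * (sin t * cos t)" by (simp add: sin_double)
    finally have A: "1 \<le> (real n + 1) * (sin t * cos t)" .
    have "(sin t * cos t) * (3 * \<bar>poly (pderiv (pderiv q)) y\<bar>) = \<bar>sin t * (3 * (y * poly (pderiv (pderiv q)) y))\<bar>"
      using s c t by (simp add: abs_mult)
    also have "\<dots> \<le> K"
      unfolding D_crit[OF crit] using ob[of t] t by simp
    also have "\<dots> \<le> K * ((real n + 1) * (sin t * cos t))"
      using mult_left_mono[OF A K] by simp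
    finally have "(sin t * cos t) * (3 * \<bar>poly (pderiv (pderiv q)) y\<bar>) \<le> (sin t * cos t) * (K * (real n + 1))"
      by (simp add: algebra_simps)
    thus ?thesis using s c unfolding K_def by simp
  next
    case 4
    note [derivative_intros] = DERIV_chain2[OF poly_DERIV]
    \<comment> \<open>The weight \<open>sin u ^ 3\<close> is an integrating factor: \<open>G\<close>
      has derivative \<open>(sin u) ^ 2 * osc q (cos u)\<close>, of modulus at most
      \<open>K * sin u\<close> on \<open>[0, t]\<close>. As \<open>G 0 = 0\<close>, the modulus of
      \<open>G t\<close> is at most \<open>K * (1 - cos t)\<close>.\<close>
    define G where "G u = sin u ^ 3 * poly (pderiv (pderiv q)) (cos u)" for u
    have G': "(G has_real_derivative sin u * (sin u * poly (osc q) (cos u))) (at u)" for u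
    proof -
      have s: "sin u ^ 4 = (sin u)\<^sup>2 * (1 - (cos u)\<^sup>2)"
        by (simp add: sin_squared_eq[symmetric])
      have "(G has_real_derivative 3 * (sin u)\<^sup>2 * cos u * poly (pderiv (pderiv q)) (cos u)
          - sin u ^ 4 * poly (pderiv (pderiv (pderiv q))) (cos u)) (at u)"
        unfolding G_def by (auto intro!: derivative_eq_intros simp: power2_eq_square power3_eq_cube eval_nat_numeral)
      also have "3 * (sin u)\<^sup>2 * cos u * poly (pderiv (pderiv q)) (cos u)
          - sin u ^ 4 * poly (pderiv (pderiv (pderiv q))) (cos u) = sin u * (sin u * poly (osc q) (cos u))"
        unfolding s osc_def by (simp add: algebra_simps power2_eq_square)
      finally show ?thesis .
    qed
    have mono: "G 0 * c - K * cos 0 \<le> G t * c - K * cos t" if c: "\<bar>c\<bar> = 1" for c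
    proof (rule DERIV_nonneg_imp_nondecreasing[OF t(2)])
      fix u assume u: "0 \<le> u" "u \<le> t"
      have "sin u \<ge> 0" using u t by (intro sin_ge_zero) auto
      moreover have "\<bar>sin u * poly (osc q) (cos u) * c\<bar> \<le> K"
        using ob[of u] c by (simp only: abs_mult mult_1_right)
      hence "0 \<le> K + sin u * poly (osc q) (cos u) * c" by linarith
      ultimately have "0 \<le> sin u * (K + sin u * poly (osc q) (cos u) * c)" by simp
      moreover have "((\<lambda>u. G u * c - K * cos u) has_real_derivative
          sin u * (K + sin u * poly (osc q) (cos u) * c)) (at u)"
        by (auto intro!: derivative_eq_intros G' simp: algebra_simps)
      ultimately show "\<exists>y. ((\<lambda>u. G u * c - K * cos u) has_real_derivative y) (at u) \<and> 0 \<le> y" by blast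
    qed
    have G: "\<bar>G t\<bar> \<le> K * (1 - cos t)"
      using mono[of 1] mono[of "-1"] by (simp add: G_def algebra_simps)
    have s: "sin t > 0" using 4(3) t by (intro sin_gt_zero) (auto intro: order.strict_trans[of _ "pi / 4"])
    have "cos t < cos (pi / 4)" using 4(3) t by (intro cos_monotone_0_pi) auto
    hence "y\<^sup>2 < 1 / 2" using power_strict_mono[of y "cos (pi / 4)" 2] t y
      by (simp add: cos_45 power_divide)
    \<comment> \<open>Multiplied by \<open>(1 - y) ^ 2\<close>, this becomes
      \<open>(1 - y) ^ 2 \<le> (1 - y ^ 2) ^ 3 = sin t ^ 6\<close>. Hence
      \<open>1 - y \<le> sin t ^ 3\<close>, and the weight in \<open>G\<close> cancels.\<close>
    have "(1 - y) * (1 + y) ^ 3 \<ge> 1"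
    proof -
      have "(1 - y) * (1 + y) ^ 3 = 1 + y * (2 - 2 * y\<^sup>2 - y * y\<^sup>2)"
        by (simp add: power2_eq_square power3_eq_cube algebra_simps)
      moreover have "y * y\<^sup>2 \<le> 1 * y\<^sup>2" using y by (intro mult_right_mono) auto
      ultimately show ?thesis using \<open>y\<^sup>2 < 1 / 2\<close> y by simp
    qed
    hence "(1 - y)\<^sup>2 * 1 \<le> (1 - y)\<^sup>2 * ((1 - y) * (1 + y) ^ 3)"
      by (intro mult_left_mono) auto
    also have "\<dots> = (1 - y\<^sup>2) ^ 3" by (simp add: power2_eq_square power3_eq_cube algebra_simps)
    also have "1 - y\<^sup>2 = (sin t)\<^sup>2" using t(1) by (simp add: sin_squared_eq)
    also have "((sin t)\<^sup>2) ^ 3 = (sin t ^ 3)\<^sup>2" by (simp flip: power_mult)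
    finally have "(1 - y)\<^sup>2 \<le> (sin t ^ 3)\<^sup>2" by (simp only: mult_1_right)
    hence "1 - y \<le> sin t ^ 3" by (rule power2_le_imp_le) (use s in simp)
    hence "\<bar>G t\<bar> \<le> K * sin t ^ 3" using G t mult_left_mono[OF _ K] by fastforce
    hence "\<bar>poly (pderiv (pderiv q)) y\<bar> \<le> K" using s t unfolding G_def by (simp add: abs_mult mult.commute)
    \<comment> \<open>For \<open>n \<ge> 2\<close> the factor \<open>(n + 1) / 3\<close> is at least
      \<open>1\<close>.\<close>
    also have "K * 1 \<le> K * ((real n + 1) / 3)" using K 4(1) by (intro mult_left_mono) auto
    finally show ?thesis unfolding K_def by simp
  qed
qed

text \<open>The modulus of \<open>q''\<close> attains its maximum at an endpoint or at a zero of
  \<open>q'''\<close>, and the reflection \<open>x -> -x\<close> moves the maximum point into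
  \<open>[0, 1]\<close>. The bound is \<open>B\<close> times the second derivative of the Chebyshev
  polynomial \<open>T n\<close> at \<open>1\<close>.\<close>

lemma markov_second_derivative:
  fixes q :: "real poly"
  assumes deg: "degree q \<le> n"
    and bd: "\<And>x. -1 \<le> x \<Longrightarrow> x \<le> 1 \<Longrightarrow> \<bar>poly q x\<bar> \<le> B"
    and x: "-1 \<le> x" "x \<le> 1"
  shows "\<bar>poly (pderiv (pderiv q)) x\<bar> \<le> B * (real n)\<^sup>2 * ((real n)\<^sup>2 - 1) / 3"
proof (cases "n \<le> 1")
  case True
  hence "degree (pderiv q) = 0" using deg by (simp add: degree_pderiv)
  hence "pderiv (pderiv q) = 0" by (simp add: pderiv_eq_0_iff)
  moreover have "n = 0 \<or> n = 1" using True by auto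
  ultimately show ?thesis by auto
next
  case False
  then obtain m where m: "n = Suc m" "m \<ge> 1" by (cases n) auto
  define f where "f x = \<bar>poly (pderiv (pderiv q)) x\<bar>" for x
  have "continuous_on {-1..1} f" unfolding f_def by (intro continuous_intros)
  then obtain y where y: "y \<in> {-1..1}" "\<And>z. z \<in> {-1..1} \<Longrightarrow> f z \<le> f y"
    using continuous_attains_sup[of "{-1..1::real}" f] by auto
  have crit: "poly (pderiv (pderiv (pderiv q))) y = 0" if "-1 < y" "y < 1"
  proof -
    define r where "r = pderiv (pderiv q)"
    have le: "\<bar>poly r z\<bar> \<le> \<bar>poly r y\<bar>" if "\<bar>y - z\<bar> < min (1 - y) (y + 1)" for z
    proof -
      have "-1 \<le> z" "z \<le> 1" using that by (auto simp: abs_less_iff)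
      thus ?thesis using y(2)[of z] unfolding f_def r_def by simp
    qed
    have "poly (pderiv r) y = 0"
    proof (cases "poly r y \<ge> 0")
      case True
      have "\<forall>z. \<bar>y - z\<bar> < min (1 - y) (y + 1) \<longrightarrow> poly r z \<le> poly r y"
        using le True by fastforce
      thus ?thesis using that by (intro DERIV_local_max[OF poly_DERIV[of r y], of "min (1 - y) (y + 1)"]) auto
    next
      case False
      have "\<forall>z. \<bar>y - z\<bar> < min (1 - y) (y + 1) \<longrightarrow> poly r y \<le> poly r z"
        using le False by fastforce
      thus ?thesis using that by (intro DERIV_local_min[OF poly_DERIV[of r y], of "min (1 - y) (y + 1)"]) auto
    qed
    thus ?thesis unfolding r_def .
  qed
  define K where "K = B * (real m * (real m + 1) * (real m + 2)) * (real m + 1) / 3"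
  have "f y \<le> K"
  proof (cases "y \<ge> 0")
    case True
    have "y = 1 \<or> poly (pderiv (pderiv (pderiv q))) y = 0" using True y(1) crit by fastforce
    from markov_second_critical[OF _ m(2) bd True _ this] show ?thesis
      using deg y(1) m unfolding f_def K_def by auto
  next
    case False
    define q' where "q' = q \<circ>\<^sub>p [:0, -1:]"
    have pd: "pderiv (p \<circ>\<^sub>p [:0, -1:]) = - (pderiv p \<circ>\<^sub>p [:0, -1:])" for p :: "real poly"
      by (simp add: pderiv_pcompose pderiv_pCons)
    have d: "pderiv (pderiv q') = pderiv (pderiv q) \<circ>\<^sub>p [:0, -1:]"
         "pderiv (pderiv (pderiv q')) = - (pderiv (pderiv (pderiv q)) \<circ>\<^sub>p [:0, -1:])"
      by (simp_all add: q'_def pd pderiv_minus)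
    have "degree q' \<le> Suc m" using deg m unfolding q'_def by (simp add: degree_pcompose)
    moreover have "\<bar>poly q' x\<bar> \<le> B" if "-1 \<le> x" "x \<le> 1" for x
      using bd[of "-x"] that by (simp add: q'_def poly_pcompose)
    moreover have "- y = 1 \<or> poly (pderiv (pderiv (pderiv q'))) (- y) = 0"
    proof (cases "y = -1")
      case False
      hence "poly (pderiv (pderiv (pderiv q))) y = 0" using y(1) \<open>\<not> y \<ge> 0\<close> by (intro crit) auto
      thus ?thesis unfolding d(2) by (simp add: poly_pcompose)
    qed simp
    ultimately have "\<bar>poly (pderiv (pderiv q')) (- y)\<bar> \<le> K"
      using y(1) False unfolding K_def by (intro markov_second_critical[OF _ m(2)]) auto
    thus ?thesis by (simp add: d poly_pcompose f_def)
  qed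
  moreover have "f x \<le> f y" using x by (intro y) auto
  moreover have "K = B * (real n)\<^sup>2 * ((real n)\<^sup>2 - 1) / 3"
    unfolding K_def m by (simp add: power2_eq_square algebra_simps)
  ultimately show ?thesis by (simp add: f_def)
qed

subsection \<open>Polynomials decreasing at the nodes\<close>

text \<open>Mapping \<open>[-1, 1]\<close> affinely onto \<open>[0, l]\<close> and centring the
  values at \<open>c + M / 2\<close> reduces the claim to \<open>B = M / 2\<close>; the two
  derivatives contribute the factor \<open>(l / 2) ^ 2\<close>.\<close>

lemma second_derivative_bound_interval:
  fixes q :: "real poly"
  assumes deg: "degree q \<le> n" and l: "l > 0"
    and bd: "\<And>x. 0 \<le> x \<Longrightarrow> x \<le> l \<Longrightarrow> c \<le> poly q x \<and> poly q x \<le> c + M"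
    and x: "0 \<le> x" "x \<le> l"
  shows "\<bar>poly (pderiv (pderiv q)) x\<bar> \<le> 2 * (real n)\<^sup>2 * ((real n)\<^sup>2 - 1) / (3 * l\<^sup>2) * M"
proof -
  define r where "r = q \<circ>\<^sub>p [:l / 2, l / 2:] - [:c + M / 2:]"
  have "degree r \<le> n" unfolding r_def
    using deg by (intro degree_diff_le) (auto simp: degree_pcompose)
  moreover have "\<bar>poly r z\<bar> \<le> M / 2" if "-1 \<le> z" "z \<le> 1" for z
  proof -
    have "l / 2 + z * (l / 2) = (l / 2) * (1 + z)" by (simp add: algebra_simps)
    moreover have "0 \<le> (l / 2) * (1 + z)" "(l / 2) * (1 + z) \<le> (l / 2) * 2"
      using that l by (auto intro!: mult_left_mono)
    ultimately have "c \<le> poly q (l / 2 + z * (l / 2)) \<and> poly q (l / 2 + z * (l / 2)) \<le> c + M"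
      by (intro bd) auto
    moreover have "poly r z = poly q (l / 2 + z * (l / 2)) - (c + M / 2)"
      by (simp add: r_def poly_pcompose)
    ultimately show ?thesis by (simp only: abs_le_iff) linarith
  qed
  moreover define z where "z = 2 * x / l - 1"
  have z: "-1 \<le> z" "z \<le> 1" "l / 2 + z * (l / 2) = x" using x l by (auto simp: z_def field_simps)
  ultimately have "\<bar>poly (pderiv (pderiv r)) z\<bar> \<le> M / 2 * (real n)\<^sup>2 * ((real n)\<^sup>2 - 1) / 3"
    by (intro markov_second_derivative) auto
  moreover have "poly (pderiv (pderiv r)) z = (l / 2)\<^sup>2 * poly (pderiv (pderiv q)) x"
    unfolding r_def using z(3)
    by (simp add: pderiv_pcompose pderiv_diff pderiv_pCons poly_pcompose pderiv_smult pderiv_mult power2_eq_square)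
  ultimately have "(l / 2)\<^sup>2 * \<bar>poly (pderiv (pderiv q)) x\<bar> \<le> M / 2 * (real n)\<^sup>2 * ((real n)\<^sup>2 - 1) / 3"
    by (simp add: abs_mult)
  thus ?thesis using l by (simp add: field_simps power2_eq_square)
qed

section \<open>Positive variation over intervals\<close>

lemma has_integral_ramp:
  fixes a b L :: real
  assumes "a \<le> b"
  shows "((\<lambda>x. L * (x - a)) has_integral L * (b - a)\<^sup>2 / 2) {a..b}"
    and "((\<lambda>x. L * (b - x)) has_integral L * (b - a)\<^sup>2 / 2) {a..b}"
proof -
  have "((\<lambda>x. L * (x - a)) has_integral L * (b - a)\<^sup>2 / 2 - L * (a - a)\<^sup>2 / 2) {a..b}"
    using assms by (intro fundamental_theorem_of_calculus)
      (auto intro!: derivative_eq_intros simp flip: has_real_derivative_iff_has_vector_derivative)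
  thus "((\<lambda>x. L * (x - a)) has_integral L * (b - a)\<^sup>2 / 2) {a..b}" by simp
  have "((\<lambda>x. L * (b - x)) has_integral - L * (b - b)\<^sup>2 / 2 - - L * (b - a)\<^sup>2 / 2) {a..b}"
    using assms by (intro fundamental_theorem_of_calculus)
      (auto intro!: derivative_eq_intros simp: field_simps simp flip: has_real_derivative_iff_has_vector_derivative)
  thus "((\<lambda>x. L * (b - x)) has_integral L * (b - a)\<^sup>2 / 2) {a..b}" by simp
qed

context
  fixes q :: "real poly"
begin

text \<open>The positive variation of \<open>q\<close>. Unlike the increment of \<open>q\<close>, it
  cannot decrease when the interval grows.\<close>

definition rise :: "real \<Rightarrow> real \<Rightarrow> real" where
  "rise a b = integral {a..b} (\<lambda>x. max (poly (pderiv q) x) 0)"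

lemma rise_integrable: "(\<lambda>x. max (poly (pderiv q) x) 0) integrable_on {a..b}"
  by (intro integrable_continuous_interval continuous_intros)

lemma rise_nonneg: "0 \<le> rise a b"
  unfolding rise_def by (intro integral_nonneg rise_integrable) auto

lemma rise_combine: "a \<le> b \<Longrightarrow> b \<le> c \<Longrightarrow> rise a c = rise a b + rise b c"
  unfolding rise_def by (rule Henstock_Kurzweil_Integration.integral_combine[symmetric]) (auto intro: rise_integrable)

lemma diff_le_rise:
  assumes "a \<le> b"
  shows "poly q b - poly q a \<le> rise a b"
proof -
  have "((\<lambda>x. poly (pderiv q) x) has_integral (poly q b - poly q a)) {a..b}"
    using assms by (intro fundamental_theorem_of_calculus)
      (auto intro!: has_field_derivative_at_within poly_DERIV simp flip: has_real_derivative_iff_has_vector_derivative)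
  thus ?thesis unfolding rise_def
    by (intro has_integral_le[OF _ integrable_integral[OF rise_integrable]]) auto
qed

text \<open>If \<open>v < u\<close>, then \<open>poly q 0 \<le> poly q l\<close> bounds the
  difference by the sum of the increments over \<open>[0, v]\<close> and \<open>[u, l]\<close>,
  which are disjoint.\<close>

lemma oscillation_le_rise:
  assumes "0 \<le> l" "poly q 0 \<le> poly q l" "0 \<le> u" "u \<le> l" "0 \<le> v" "v \<le> l"
  shows "poly q v - poly q u \<le> rise 0 l"
proof (cases "u \<le> v")
  case True
  have "rise 0 l = rise 0 u + rise u v + rise v l"
    using assms True rise_combine[of 0 u l] rise_combine[of u v l] by simp
  thus ?thesis using diff_le_rise[OF True] rise_nonneg[of 0 u] rise_nonneg[of v l] by simp
next
  case False
  have "rise 0 l = rise 0 v + rise v u + rise u l"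
    using assms False rise_combine[of 0 v l] rise_combine[of v u l] by simp
  thus ?thesis using diff_le_rise[of 0 v] diff_le_rise[of u l] rise_nonneg[of v u] assms by simp
qed

lemma rise_le_of_bound:
  assumes "a \<le> b" "\<And>x. a \<le> x \<Longrightarrow> x \<le> b \<Longrightarrow> poly (pderiv q) x \<le> f x" 
    "\<And>x. a \<le> x \<Longrightarrow> x \<le> b \<Longrightarrow> 0 \<le> f x" "(f has_integral I) {a..b}"
  shows "rise a b \<le> I"
  unfolding rise_def using assms
  by (intro has_integral_le[OF integrable_integral[OF rise_integrable]]) auto

lemma pderiv_le_right:
  assumes "a \<le> b" "\<And>x. a \<le> x \<Longrightarrow> x \<le> b \<Longrightarrow> \<bar>poly (pderiv (pderiv q)) x\<bar> \<le> L" "poly (pderiv q) b \<le> 0"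
    and x: "a \<le> x" "x \<le> b"
  shows "poly (pderiv q) x \<le> L * (b - x)"
proof (cases "x = b")
  case False
  then obtain \<xi> where "\<xi> > x" "\<xi> < b" "poly (pderiv q) b - poly (pderiv q) x = (b - x) * poly (pderiv (pderiv q)) \<xi>"
    using poly_MVT[of x b "pderiv q"] x by auto
  moreover have "(b - x) * (- poly (pderiv (pderiv q)) \<xi>) \<le> (b - x) * L"
    using assms(2)[of \<xi>] x calculation by (intro mult_left_mono) auto
  ultimately show ?thesis using assms(3) by (simp add: algebra_simps)
qed (use assms in simp)

lemma pderiv_le_left:
  assumes "a \<le> b" "\<And>x. a \<le> x \<Longrightarrow> x \<le> b \<Longrightarrow> \<bar>poly (pderiv (pderiv q)) x\<bar> \<le> L" "poly (pderiv q) a \<le> 0"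
    and x: "a \<le> x" "x \<le> b"
  shows "poly (pderiv q) x \<le> L * (x - a)"
proof (cases "x = a")
  case False
  then obtain \<xi> where "\<xi> > a" "\<xi> < x" "poly (pderiv q) x - poly (pderiv q) a = (x - a) * poly (pderiv (pderiv q)) \<xi>"
    using poly_MVT[of a x "pderiv q"] x by auto
  moreover have "(x - a) * poly (pderiv (pderiv q)) \<xi> \<le> (x - a) * L"
    using assms(2)[of \<xi>] x calculation by (intro mult_left_mono) auto
  ultimately show ?thesis using assms(3) by (simp add: algebra_simps)
qed (use assms in simp)

text \<open>\<open>q'\<close> lies below the ramp \<open>L * (b - x)\<close>. This version serves
  \<open>[0, 1]\<close>, where no sign of \<open>q'\<close> is known at the left end.\<close>

lemma rise_le_one_sided:
  assumes "a \<le> b" "\<And>x. a \<le> x \<Longrightarrow> x \<le> b \<Longrightarrow> \<bar>poly (pderiv (pderiv q)) x\<bar> \<le> L" "poly (pderiv q) b \<le> 0"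
  shows "rise a b \<le> L * (b - a)\<^sup>2 / 2"
proof (rule rise_le_of_bound[OF assms(1) pderiv_le_right[OF assms] _ has_integral_ramp(2)[OF assms(1)]])
  have "L \<ge> 0" using assms(2)[OF order_refl assms(1)] by simp
  thus "0 \<le> L * (b - x)" if "a \<le> x" "x \<le> b" for x using that by simp
qed

lemma rise_le_one_sided':
  assumes "a \<le> b" "\<And>x. a \<le> x \<Longrightarrow> x \<le> b \<Longrightarrow> \<bar>poly (pderiv (pderiv q)) x\<bar> \<le> L" "poly (pderiv q) a \<le> 0"
  shows "rise a b \<le> L * (b - a)\<^sup>2 / 2"
proof (rule rise_le_of_bound[OF assms(1) pderiv_le_left[OF assms] _ has_integral_ramp(1)[OF assms(1)]])
  have "L \<ge> 0" using assms(2)[OF order_refl assms(1)] by simp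
  thus "0 \<le> L * (x - a)" if "a \<le> x" "x \<le> b" for x using that by simp
qed

text \<open>\<open>q'\<close> lies below a tent with feet at \<open>a\<close> and \<open>b\<close>;
  cutting at the midpoint halves the one-sided bound.\<close>

lemma rise_le_two_sided:
  assumes "a \<le> b" "\<And>x. a \<le> x \<Longrightarrow> x \<le> b \<Longrightarrow> \<bar>poly (pderiv (pderiv q)) x\<bar> \<le> L"
    "poly (pderiv q) a \<le> 0" "poly (pderiv q) b \<le> 0"
  shows "rise a b \<le> L * (b - a)\<^sup>2 / 4"
proof -
  have m: "a \<le> (a + b) / 2" "(a + b) / 2 \<le> b" using assms(1) by auto
  have h: "(a + b) / 2 - a = (b - a) / 2" "b - (a + b) / 2 = (b - a) / 2" by (simp_all add: field_simps)
  have "rise a ((a + b) / 2) \<le> L * ((b - a) / 2)\<^sup>2 / 2"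
    using rise_le_one_sided'[OF m(1) _ assms(3), of L] assms(2) m(2) unfolding h by auto
  moreover have "rise ((a + b) / 2) b \<le> L * ((b - a) / 2)\<^sup>2 / 2"
    using rise_le_one_sided[OF m(2) _ assms(4), of L] assms(2) m(1) unfolding h by auto
  ultimately show ?thesis using rise_combine[OF m] by (simp add: power_divide)
qed

lemma rise_sum: "rise 0 (real m) = (\<Sum>j<m. rise (real j) (real j + 1))"
proof (induction m)
  case 0
  show ?case by (simp add: rise_def)
next
  case (Suc m)
  thus ?case using rise_combine[of 0 "real m" "real m + 1"] by (simp add: add.commute)
qed

lemma rise_eq_0:
  assumes "\<And>x. a \<le> x \<Longrightarrow> x \<le> b \<Longrightarrow> poly (pderiv q) x \<le> 0"
  shows "rise a b = 0"
  unfolding rise_def using assms by (subst integral_cong[of _ _ "\<lambda>_. 0"]) auto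

text \<open>Subtracting a small \<open>\<epsilon>\<close> from the derivative makes it strictly negative at the nodes, so that
  the two sign changes in a unit interval are roots interior to it and no root is counted twice.\<close>

lemma card_rising_intervals:
  assumes k: "k \<ge> 1" and deg: "degree q \<le> n"
    and nodes: "\<And>j. 1 \<le> j \<Longrightarrow> j \<le> k \<Longrightarrow> poly (pderiv q) (real j) \<le> 0"
    and first: "\<exists>x. 0 < x \<and> x < 1 \<and> poly (pderiv q) x > 0"
    and N: "N = {j \<in> {1..<k}. \<exists>x. real j < x \<and> x < real j + 1 \<and> poly (pderiv q) x > 0}"
  shows "2 * card N + 2 \<le> n"
proof -
  have fin: "finite N" unfolding N by simp
  obtain x0 where x0: "0 < x0" "x0 < 1" "poly (pderiv q) x0 > 0" using first by blast
  have "\<exists>x. real j < x \<and> x < real j + 1 \<and> poly (pderiv q) x > 0" if "j \<in> N" for j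
    using that unfolding N by blast
  then obtain x where x: "\<And>j. j \<in> N \<Longrightarrow> real j < x j \<and> x j < real j + 1 \<and> poly (pderiv q) (x j) > 0"
    by metis
  define e where "e = Min (insert (poly (pderiv q) x0) ((\<lambda>j. poly (pderiv q) (x j)) ` N)) / 2"
  have "e > 0" unfolding e_def using fin x x0 by (auto simp: Min_gr_iff)
  have e2: "e < z" if "z \<in> insert (poly (pderiv q) x0) ((\<lambda>j. poly (pderiv q) (x j)) ` N)" for z
  proof -
    have "2 * e \<le> z" unfolding e_def using that fin by simp
    thus ?thesis using \<open>e > 0\<close> by simp
  qed
  define r where "r = pderiv q - [:e:]"
  have neg: "poly r (real j) < 0" if "1 \<le> j" "j \<le> k" for j
    using nodes[OF that] \<open>e > 0\<close> by (simp add: r_def)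
  have pos0: "poly r x0 > 0" using e2[of "poly (pderiv q) x0"] by (simp add: r_def)
  have pos: "poly r (x j) > 0" if "j \<in> N" for j using e2[of "poly (pderiv q) (x j)"] that by (simp add: r_def)
  \<comment> \<open>\<open>[0, 1]\<close> contributes only one sign change, since the slope at
    \<open>0\<close> is not controlled.\<close>
  obtain z0 where z0: "x0 < z0" "z0 < 1" "poly r z0 = 0"
    using poly_IVT_neg[of x0 1 r] x0 pos0 neg[of 1] k by auto
  have "\<exists>z. real j < z \<and> z < x j \<and> poly r z = 0" if "j \<in> N" for j
    using poly_IVT_pos[of "real j" "x j" r] x[OF that] pos[OF that] neg[of j] that unfolding N by auto
  then obtain y where y: "\<And>j. j \<in> N \<Longrightarrow> real j < y j \<and> y j < x j \<and> poly r (y j) = 0" by metis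
  have "\<exists>z. x j < z \<and> z < real j + 1 \<and> poly r z = 0" if "j \<in> N" for j
    using poly_IVT_neg[of "x j" "real j + 1" r] x[OF that] pos[OF that] neg[of "Suc j"] that unfolding N
    by (auto simp: add.commute)
  then obtain z where z: "\<And>j. j \<in> N \<Longrightarrow> x j < z j \<and> z j < real j + 1 \<and> poly r (z j) = 0" by metis
  have fl_y: "\<lfloor>y j\<rfloor> = int j" if "j \<in> N" for j
    using y[OF that] x[OF that] by (intro floor_unique) auto
  have fl_z: "\<lfloor>z j\<rfloor> = int j" if "j \<in> N" for j
    using z[OF that] x[OF that] by (intro floor_unique) auto
  have inj: "inj_on y N" "inj_on z N" by (metis fl_y inj_onI of_nat_eq_iff, metis fl_z inj_onI of_nat_eq_iff)
  have "y ` N \<inter> z ` N = {}"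
  proof (rule ccontr)
    assume "y ` N \<inter> z ` N \<noteq> {}"
    then obtain i j where ij: "i \<in> N" "j \<in> N" "y i = z j" by blast
    hence "i = j" using fl_y[of i] fl_z[of j] by simp
    thus False using ij y[of i] z[of i] by simp
  qed
  hence "card (y ` N \<union> z ` N) = 2 * card N"
    using fin inj by (simp add: card_Un_disjoint card_image)
  moreover have "z0 \<notin> y ` N \<union> z ` N"
  proof -
    have "\<lfloor>z0\<rfloor> = 0" using z0 x0 by (intro floor_unique) auto
    moreover have "0 \<notin> N" unfolding N by simp
    ultimately show ?thesis using fl_y fl_z by fastforce
  qed
  ultimately have "card (insert z0 (y ` N \<union> z ` N)) = 2 * card N + 1" using fin by simp
  moreover have "card (insert z0 (y ` N \<union> z ` N)) \<le> card {u. poly r u = 0}"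
    using y z z0 pos0 by (intro card_mono poly_roots_finite) auto
  moreover have "card {u. poly r u = 0} \<le> degree r" using pos0 by (intro card_poly_roots_bound) auto
  ultimately have "2 * card N + 1 \<le> degree r" by linarith
  also have "degree r \<le> n - 1" unfolding r_def
    using deg by (intro degree_diff_le) (auto simp: degree_pderiv)
  finally show ?thesis by simp
qed

end

text \<open>The triviality condition for \<open>stiemke\<close>. Without a rise in
  \<open>(0, 1)\<close>, \<open>q\<close> descends from \<open>q 0 \<le> 0\<close> to
  \<open>q 1 \<ge> 0\<close> and so vanishes on \<open>[0, 1]\<close>. Otherwise its oscillation on
  \<open>[0, k]\<close> is at most a constant below \<open>1\<close> times itself, hence
  zero.\<close>

lemma monotone_nodes_imp_zero:
  fixes q :: "real poly"
  assumes deg: "degree q \<le> p" and k: "k \<ge> 1"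
    and big: "(real p)\<^sup>2 * ((real p)\<^sup>2 - 1) / 6 * real (p div 2 + 1) < (real k)\<^sup>2"
    and q0: "poly q 0 \<le> 0"
    and val: "\<And>j. 1 \<le> j \<Longrightarrow> j \<le> k \<Longrightarrow> 0 \<le> poly q (real j)"
    and slope: "\<And>j. 1 \<le> j \<Longrightarrow> j \<le> k \<Longrightarrow> poly (pderiv q) (real j) \<le> 0"
  shows "q = 0"
proof (cases "\<exists>x. 0 < x \<and> x < 1 \<and> poly (pderiv q) x > 0")
  case False
  have noninc: "poly q v \<le> poly q u" if "0 \<le> u" "u \<le> v" "v \<le> 1" for u v
  proof (cases "u = v")
    case neq: False
    then obtain \<xi> where "u < \<xi>" "\<xi> < v" "poly q v - poly q u = (v - u) * poly (pderiv q) \<xi>"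
      using poly_MVT[of u v q] \<open>u \<le> v\<close> by auto
    moreover from this have "0 < \<xi>" "\<xi> < 1" using that by linarith+
    hence "poly (pderiv q) \<xi> \<le> 0" using False by (meson not_less)
    hence "(v - u) * poly (pderiv q) \<xi> \<le> 0" using that by (intro mult_nonneg_nonpos) auto
    ultimately show ?thesis by simp
  qed simp
  have "poly q x = 0" if "x \<in> {0..1}" for x
    using noninc[of 0 x] noninc[of x 1] q0 val[of 1] k that by simp
  hence "{0..1} \<subseteq> {x. poly q x = 0}" by auto
  moreover have "infinite {0..1::real}" by simp
  ultimately have "infinite {x. poly q x = 0}" using infinite_super by blast
  thus ?thesis using poly_roots_finite by blast
next
  case True
  define N where "N = {j \<in> {1..<k}. \<exists>x. real j < x \<and> x < real j + 1 \<and> poly (pderiv q) x > 0}"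
  have N: "card N + 1 \<le> p div 2" using card_rising_intervals[OF k deg slope True N_def] by simp
  have cont: "continuous_on {0..real k} (poly q)" by (intro continuous_intros)
  obtain u where u: "u \<in> {0..real k}" "\<And>x. x \<in> {0..real k} \<Longrightarrow> poly q u \<le> poly q x"
    using continuous_attains_inf[OF compact_Icc _ cont] by auto
  obtain v where v: "v \<in> {0..real k}" "\<And>x. x \<in> {0..real k} \<Longrightarrow> poly q x \<le> poly q v"
    using continuous_attains_sup[OF compact_Icc _ cont] by auto
  define M where "M = poly q v - poly q u"
  define L where "L = 2 * (real p)\<^sup>2 * ((real p)\<^sup>2 - 1) / (3 * (real k)\<^sup>2) * M"
  have "M \<ge> 0" using u(2)[OF v(1)] by (simp add: M_def)
  have L: "\<bar>poly (pderiv (pderiv q)) x\<bar> \<le> L" if "0 \<le> x" "x \<le> real k" for x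
    unfolding L_def
  proof (rule second_derivative_bound_interval[OF deg _ _ that, where c = "poly q u"])
    show "poly q u \<le> poly q x \<and> poly q x \<le> poly q u + M" if "0 \<le> x" "x \<le> real k" for x
      using u(2)[of x] v(2)[of x] that by (simp add: M_def)
  qed (use k in simp)
  have "L \<ge> 0" using L[of 0] by simp
  \<comment> \<open>\<open>[0, 1]\<close> counts as two of the quarters \<open>L / 4\<close>, hence
    \<open>card N + 2\<close> below.\<close>
  have "rise q 0 1 \<le> L / 2"
    using rise_le_one_sided[of 0 1 q L] L k slope[of 1] by auto
  moreover have "rise q (real j) (real j + 1) \<le> (if j \<in> N then L / 4 else 0)" if "1 \<le> j" "j < k" for j
  proof (cases "j \<in> N")
    case True
    have "rise q (real j) (real j + 1) \<le> L * (real j + 1 - real j)\<^sup>2 / 4"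
      using that slope[of j] slope[of "Suc j"]
      by (intro rise_le_two_sided L) (auto simp: add.commute)
    thus ?thesis using True by simp
  next
    case False
    have "poly (pderiv q) x \<le> 0" if "real j \<le> x" "x \<le> real j + 1" for x
    proof (cases "x = real j \<or> x = real j + 1")
      case True
      thus ?thesis using slope[of j] slope[of "Suc j"] \<open>1 \<le> j\<close> \<open>j < k\<close> by (auto simp: add.commute)
    next
      case inner: False
      hence "real j < x" "x < real j + 1" using that by auto
      moreover have "j \<in> {1..<k}" using \<open>1 \<le> j\<close> \<open>j < k\<close> by simp
      ultimately show ?thesis using False unfolding N_def by (simp add: not_less) (meson not_less)
    qed
    thus ?thesis using rise_eq_0[of "real j" "real j + 1" q] False by simp
  qed
  moreover have "rise q 0 (real k) = rise q 0 1 + (\<Sum>j\<in>{1..<k}. rise q (real j) (real j + 1))"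
  proof -
    have "rise q 0 (real k) = (\<Sum>j<k. rise q (real j) (real j + 1))"
      by (rule rise_sum)
    moreover have "{..<k} = insert 0 {1..<k}" using k by auto
    ultimately show ?thesis by simp
  qed
  ultimately have "rise q 0 (real k) \<le> L / 2 + (\<Sum>j\<in>{1..<k}. if j \<in> N then L / 4 else 0)"
    using sum_mono[of "{1..<k}" "\<lambda>j. rise q (real j) (real j + 1)" "\<lambda>j. if j \<in> N then L / 4 else 0"]
    by simp
  moreover have "(\<Sum>j\<in>{1..<k}. if j \<in> N then L / 4 else 0) = real (card N) * (L / 4)"
  proof -
    have "{1..<k} \<inter> N = N" unfolding N_def by blast
    thus ?thesis using sum.inter_restrict[of "{1..<k}" "\<lambda>_. L / 4" N] by simp
  qed
  ultimately have "rise q 0 (real k) \<le> real (card N + 2) * (L / 4)" by (simp add: algebra_simps)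
  also have "\<dots> \<le> real (p div 2 + 1) * (L / 4)"
    using N \<open>L \<ge> 0\<close> by (intro mult_right_mono) (auto simp del: of_nat_add)
  finally have "M \<le> real (p div 2 + 1) * (L / 4)"
    using oscillation_le_rise[of "real k" q u v] u(1) v(1) q0 val[of k] k unfolding M_def by auto
  also have "\<dots> = ((real p)\<^sup>2 * ((real p)\<^sup>2 - 1) / 6 * real (p div 2 + 1)) * M / (real k)\<^sup>2"
  proof -
    have "c * (2 * x * y / (3 * z) * m / 4) = (x * y / 6 * c) * m / z" for c m x y z :: real
      by (cases "z = 0") (simp_all add: field_simps)
    thus ?thesis unfolding L_def .
  qed
  finally have Mk: "M * (real k)\<^sup>2 \<le> ((real p)\<^sup>2 * ((real p)\<^sup>2 - 1) / 6 * real (p div 2 + 1)) * M"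
    using k by (subst (asm) pos_le_divide_eq) auto
  have "M = 0"
  proof (rule ccontr)
    assume "M \<noteq> 0"
    hence "M > 0" using \<open>M \<ge> 0\<close> by simp
    from mult_strict_right_mono[OF big this] show False
      using Mk by (simp only: mult.commute[of "(real k)\<^sup>2" M])
  qed
  have const: "poly q x = poly q u" if "x \<in> {0..real k}" for x
    using u(2)[OF that] v(2)[OF that] \<open>M = 0\<close> unfolding M_def by linarith
  have "poly q u = 0" using const[of 0] const[of 1] q0 val[of 1] k by simp
  hence "poly q x = 0" if "x \<in> {0..1}" for x using const[of x] that k by simp
  hence "{0..1} \<subseteq> {x. poly q x = 0}" by blast
  moreover have "infinite {0..1::real}" by simp
  ultimately have "infinite {x. poly q x = 0}" using infinite_super by blast
  thus ?thesis using poly_roots_finite by blast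
qed

subsection \<open>Existence of methods\<close>

text \<open>A positive dependency between the functionals \<open>- q 0\<close>, \<open>q j\<close>
  and \<open>- q' j\<close> on polynomials of degree at most \<open>p\<close>, divided by the weight
  of the first, says that \<open>\<alpha> j * q j - \<beta> j * q' j\<close> sums to
  \<open>q 0\<close>. For \<open>q\<close> a monomial this is an order condition.\<close>

lemma positive_method_exists:
  assumes k: "k > 0"
    and big: "(real p)\<^sup>2 * ((real p)\<^sup>2 - 1) / 6 * real (p div 2 + 1) < (real k)\<^sup>2"
  shows "\<exists>\<alpha> \<beta>. (\<forall>j\<in>{1..k}. 0 < \<alpha> j \<and> 0 < \<beta> j) \<and> \<beta> 0 = 0 \<and> lm_order k \<alpha> \<beta> p"
proof -
  \<comment> \<open>\<open>Inl 0\<close> stands for \<open>- q 0\<close>, other \<open>Inl j\<close>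
    for \<open>q j\<close>, and \<open>Inr j\<close> for \<open>- q' j\<close>; columns are
    coefficients of \<open>q\<close>. At \<open>m = 0\<close> the factor \<open>real m\<close>
    absorbs the truncated exponent.\<close>
  define A :: "nat + nat \<Rightarrow> nat \<Rightarrow> real" where
    "A i m = (case i of Inl j \<Rightarrow> (if j = 0 then - (0 ^ m) else real j ^ m)
                      | Inr j \<Rightarrow> - (real m * real j ^ (m - 1)))" for i m
  define I where "I = {..k} <+> {1..k}"
  have mem: "Inl j \<in> I \<longleftrightarrow> j \<le> k" "Inr j \<in> I \<longleftrightarrow> j \<in> {1..k}" for j
    by (auto simp: I_def)
  have "\<exists>y. (\<forall>i\<in>I. 0 < y i) \<and> (\<forall>m\<in>{..p}. (\<Sum>i\<in>I. y i * A i m) = 0)"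
  proof (rule stiemke)
    fix x i
    assume nonneg: "\<And>i. i \<in> I \<Longrightarrow> 0 \<le> (\<Sum>m\<in>{..p}. A i m * x m)" and "i \<in> I"
    define q where "q = (\<Sum>m\<le>p. monom (x m) m)"
    have val: "poly q z = (\<Sum>m\<le>p. z ^ m * x m)" for z
      by (simp add: q_def poly_sum poly_monom mult.commute)
    have slope: "poly (pderiv q) z = (\<Sum>m\<le>p. real m * z ^ (m - 1) * x m)" for z
      by (simp add: q_def pderiv_sum poly_sum pderiv_monom poly_monom algebra_simps)
    have "q = 0"
    proof (rule monotone_nodes_imp_zero[OF _ _ big])
      show "degree q \<le> p" unfolding q_def
        by (rule degree_sum_le) (auto intro: order.trans[OF degree_monom_le])
      show "k \<ge> 1" using k by simp
      show "poly q 0 \<le> 0" using nonneg[of "Inl 0"] by (simp add: mem A_def val sum_negf)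
      show "0 \<le> poly q (real j)" if "1 \<le> j" "j \<le> k" for j
        using nonneg[of "Inl j"] that by (simp add: mem A_def val)
      show "poly (pderiv q) (real j) \<le> 0" if "1 \<le> j" "j \<le> k" for j
        using nonneg[of "Inr j"] that by (simp add: mem A_def slope sum_negf)
    qed
    have "x m = 0" if "m \<le> p" for m
    proof -
      have "coeff q m = x m" using that by (simp add: q_def coeff_sum)
      thus ?thesis using \<open>q = 0\<close> by simp
    qed
    thus "(\<Sum>m\<in>{..p}. A i m * x m) = 0" by simp
  qed (simp_all add: I_def)
  then obtain y where pos: "\<And>i. i \<in> I \<Longrightarrow> 0 < y i"
      and null: "\<And>m. m \<le> p \<Longrightarrow> (\<Sum>i\<in>I. y i * A i m) = 0"
    by auto
  define c where "c = y (Inl 0)"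
  have c: "c > 0" using pos[of "Inl 0"] by (simp add: c_def mem)
  define \<alpha> where "\<alpha> j = y (Inl j) / c" for j
  define \<beta> where "\<beta> j = (if j = 0 then 0 else y (Inr j) / c)" for j
  \<comment> \<open>By \<open>0 ^ 0 = 1\<close>, the case \<open>m = 0\<close> is the normalisation
    of \<open>\<alpha>\<close>.\<close>
  have ord: "(\<Sum>j=1..k. real j ^ m * \<alpha> j - real m * real j ^ (m - 1) * \<beta> j) = 0 ^ m" if "m \<le> p" for m
  proof -
    have "(\<Sum>i\<in>I. y i * A i m) = (\<Sum>j\<le>k. y (Inl j) * A (Inl j) m) + (\<Sum>j=1..k. y (Inr j) * A (Inr j) m)"
      unfolding I_def by (simp add: sum.Plus comp_def)
    also have "(\<Sum>j\<le>k. y (Inl j) * A (Inl j) m) = - c * 0 ^ m + (\<Sum>j=1..k. y (Inl j) * A (Inl j) m)"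
    proof -
      have "{..k} = insert 0 {1..k}" by auto
      thus ?thesis by (simp add: c_def A_def)
    qed
    also have "(\<Sum>j=1..k. y (Inl j) * A (Inl j) m) = (\<Sum>j=1..k. c * (real j ^ m * \<alpha> j))"
      using c by (intro sum.cong) (auto simp: A_def \<alpha>_def)
    also have "(\<Sum>j=1..k. y (Inr j) * A (Inr j) m) = (\<Sum>j=1..k. - (c * (real m * real j ^ (m - 1) * \<beta> j)))"
      using c by (intro sum.cong) (auto simp: A_def \<beta>_def)
    finally have "c * (\<Sum>j=1..k. real j ^ m * \<alpha> j - real m * real j ^ (m - 1) * \<beta> j) = c * 0 ^ m"
      unfolding null[OF that] sum_subtractf right_diff_distrib sum_distrib_left sum_negf by simp
    thus ?thesis using c by simp
  qed
  have "lm_order k \<alpha> \<beta> p"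
    unfolding lm_order_def
  proof (intro conjI ballI)
    show "(\<Sum>j=1..k. \<alpha> j) = 1" using ord[of 0] by simp
    show "(\<Sum>j=1..k. real j ^ m * \<alpha> j - real m * real j ^ (m - 1) * \<beta> j)
        - real m * 0 ^ (m - 1) * \<beta> 0 = 0" if "m \<in> {1..p}" for m
      using ord[of m] that by (simp add: \<beta>_def)
  qed
  moreover have "0 < \<alpha> j \<and> 0 < \<beta> j" if "j \<in> {1..k}" for j
    using that c pos[of "Inl j"] pos[of "Inr j"] by (auto simp: \<alpha>_def \<beta>_def mem)
  ultimately show ?thesis by (intro exI[of _ \<alpha>] exI[of _ \<beta>]) (auto simp: \<beta>_def)
qed

lemma ssp_coeff_pos:
  assumes pos: "\<And>j. j \<in> {1..k} \<Longrightarrow> 0 < \<alpha> j \<and> 0 < \<beta> j" and "\<beta> 0 = 0"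
  shows "ssp_coeff k \<alpha> \<beta> > 0"
proof -
  have "\<forall>j\<in>{0..k}. 0 \<le> \<beta> j"
  proof
    fix j assume "j \<in> {0..k}"
    thus "0 \<le> \<beta> j" using pos[of j] assms(2) by (cases "j = 0") auto
  qed
  moreover have "\<forall>j\<in>{1..k}. 0 \<le> \<alpha> j" using pos by (auto intro: less_imp_le)
  moreover define R where "R = {\<alpha> j / \<beta> j | j. j \<in> {1..k} \<and> \<beta> j \<noteq> 0}"
  ultimately have "ssp_coeff k \<alpha> \<beta> = (if R = {} then \<infinity> else ereal (Min R))"
    unfolding ssp_coeff_def Let_def by simp
  moreover have "finite R" unfolding R_def by simp
  moreover have "r > 0" if "r \<in> R" for r using that pos unfolding R_def by auto
  ultimately show ?thesis by (simp add: Min_gr_iff)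
qed

theorem theorem5p1:
  fixes k p :: nat
  assumes "k > 0" and "p > 0"
    and "real k > sqrt ((real p)\<^sup>2 * ((real p)\<^sup>2 - 1) / 6 * of_int \<lfloor>(real p + 2) / 2\<rfloor>)"
  shows "C_exp k p > 0 \<and>
    (\<exists>\<alpha> \<beta> :: nat \<Rightarrow> real. lm_explicit \<beta> \<and> lm_order k \<alpha> \<beta> p \<and> ssp_coeff k \<alpha> \<beta> > 0)"
proof -
  have "\<lfloor>(real p + 2) / 2\<rfloor> = int (p div 2 + 1)"
    using floor_divide_of_nat_eq[of "p + 2" 2] by (simp add: add.commute)
  hence "sqrt ((real p)\<^sup>2 * ((real p)\<^sup>2 - 1) / 6 * real (p div 2 + 1)) < real k"
    using assms(3) by simp
  hence "(real p)\<^sup>2 * ((real p)\<^sup>2 - 1) / 6 * real (p div 2 + 1) < (real k)\<^sup>2"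
    using real_less_lsqrt real_sqrt_less_iff[of _ "(real k)\<^sup>2"] by simp
  then obtain \<alpha> \<beta> where "\<And>j. j \<in> {1..k} \<Longrightarrow> 0 < \<alpha> j \<and> 0 < \<beta> j" "\<beta> 0 = 0"
      and ord: "lm_order k \<alpha> \<beta> p"
    using positive_method_exists[OF assms(1)] by metis
  hence expl: "lm_explicit \<beta>" and ssp: "ssp_coeff k \<alpha> \<beta> > 0"
    by (auto simp: lm_explicit_def intro: ssp_coeff_pos)
  \<comment> \<open>\<open>S\<close> is nonempty, so \<open>C_exp\<close> is the supremum and not
    the default \<open>0\<close>.\<close>
  define S where "S = {ssp_coeff k \<alpha> \<beta> | \<alpha> \<beta>. lm_explicit \<beta> \<and> lm_order k \<alpha> \<beta> p}"
  have "ssp_coeff k \<alpha> \<beta> \<in> S" unfolding S_def using expl ord by blast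
  hence "ssp_coeff k \<alpha> \<beta> \<le> C_exp k p"
    unfolding C_exp_def Let_def S_def[symmetric] by (auto intro: Sup_upper)
  thus ?thesis using expl ord ssp by (meson order.strict_trans2)
qed

end
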